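(* Let $U\subset\mathbb{R}^n$ be a bounded open set, let $1<s<\infty$, let $\Omega\in L^s(\mathbb{S}^{n-1})$ be a homogeneous function of degree zero, and let $q(\cdot)\in\mathcal{P}_b(U)$ satisfy the log-condition: there is a constant $A>0$ such that $$|q(x)-q(y)|\le\frac{A}{-\log\|x-y\|}\qquad\text{for all }x,y\in U\text{ with }\|x-y\|\le\tfrac12 .$$ Let $\alpha(\cdot)$ be a (measurable) function on $U$ and suppose that $$\inf_{x\in U}\alpha(x)>0,\qquad \sup_{x\in U}\alpha(x)q(x)<n,\qquad s\ge(q'(\cdot))_+,\qquad \frac1{p(\cdot)}=\frac1{q(\cdot)}-\frac{\alpha(\cdot)}n .$$ Then for every $r\in I(p_-,q_+)$ there is a constant $C>0$ such that $$\Big\|\Big(\sum_{k=1}^N|I_\Omega^{\alpha(\cdot)}(f_k)|^r\Big)^{1/r}\Big\|_{L^{p(\cdot)}(U)}\le C\,\Big\|\Big(\sum_{k=1}^N|f_k|^r\Big)^{1/r}\Big\|_{L^{q(\cdot)}(U)}$$ for every $N\in\mathbb{N}$ and every $(f_k)_{k=1}^N\subset L^{q(\cdot)}(U)$.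
   Context: $U$ carries Lebesgue measure. For a measurable $q:U\to[1,\infty]$, let $q_-=\operatorname{ess\,inf}_{U}q$, $q_+=\operatorname{ess\,sup}_{U}q$; $\mathcal{P}_b(U)$ is the set of those $q$ with $1<q_-\le q_+<\infty$. The conjugate exponent $q'(\cdot)$ is defined by $\frac1{q(x)}+\frac1{q'(x)}=1$, and $(q'(\cdot))_+=\operatorname{ess\,sup}_U q'$. For bounded exponents $p(\cdot)$, $L^{p(\cdot)}(U)$ is the (real) Banach space of measurable $f$ with $\int_U|f(x)/\lambda|^{p(x)}dx<\infty$ for some $\lambda>0$, with norm $\|f\|_{L^{p(\cdot)}(U)}=\inf\{\lambda>0:\int_U|f(x)/\lambda|^{p(x)}dx\le1\}$. The fractional integral operator of variable order $\alpha(\cdot)$ with rough kernel $\Omega$ is $$I_\Omega^{\alpha(\cdot)}f(x)=\int_{\mathbb{R}^n}\frac{\Omega(x-y)}{|x-y|^{n-\alpha(x)}}f(y)\,dy,$$ where $\Omega$ is regarded as a function on $\mathbb{R}^n\setminus\{0\}$ homogeneous of degree zero, and functions $f$ on $U$ are extended by zero outside $U$. For $p,q\in[1,\infty]$ the interval $I(p,q)$ is $$I(p,q)=\begin{cases}(q,2]&\text{if }p<q<2,\\ [2,p)&\text{if }2<p<q,\\ [\min\{2,q\},\max\{2,p\}]&\text{otherwise.}\end{cases}$$ *)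

theory Defs
  imports "HOL-Analysis.Analysis" "HOL-Probability.Essential_Supremum"
begin

section \<open>Variable exponents\<close>

definition essinf :: "'a measure \<Rightarrow> ('a \<Rightarrow> ereal) \<Rightarrow> ereal" where
  "essinf M f = - esssup M (\<lambda>x. - f x)"

definition exp_minus :: "'a::euclidean_space set \<Rightarrow> ('a \<Rightarrow> real) \<Rightarrow> ereal" where
  "exp_minus U q = essinf (lebesgue_on U) (\<lambda>x. ereal (q x))"

definition exp_plus :: "'a::euclidean_space set \<Rightarrow> ('a \<Rightarrow> real) \<Rightarrow> ereal" where
  "exp_plus U q = esssup (lebesgue_on U) (\<lambda>x. ereal (q x))"

text \<open>Exponents are real-valued: a bounded exponent is finite almost everywhere, and one that
  also satisfies the log-condition below on an open set is finite everywhere.\<close>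

definition bounded_exponents :: "'a::euclidean_space set \<Rightarrow> ('a \<Rightarrow> real) set" where
  "bounded_exponents U =
     {q \<in> borel_measurable (lebesgue_on U). (\<forall>x\<in>U. 1 \<le> q x) \<and>
        1 < exp_minus U q \<and> exp_minus U q \<le> exp_plus U q \<and> exp_plus U q < \<infinity>}"

text \<open>In \<open>ereal\<close> the inverse of \<open>0\<close> is \<open>\<infinity>\<close>, so this solves \<open>1/t + 1/t' = 1\<close> on all of
  \<open>[1, \<infinity>]\<close>, with \<open>1' = \<infinity>\<close> and \<open>\<infinity>' = 1\<close>.\<close>

definition conjugate_exponent :: "ereal \<Rightarrow> ereal" where
  "conjugate_exponent t = inverse (1 - inverse t)"

text \<open>For \<open>x = y\<close> both sides are \<open>0\<close> (\<open>ln 0 = 0\<close> and \<open>A / 0 = 0\<close>), in agreement with the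
  usual convention \<open>A / \<infinity> = 0\<close>.\<close>

definition log_condition :: "'a::euclidean_space set \<Rightarrow> ('a \<Rightarrow> real) \<Rightarrow> bool" where
  "log_condition U q \<longleftrightarrow>
     (\<exists>A>0. \<forall>x\<in>U. \<forall>y\<in>U. norm (x - y) \<le> 1/2 \<longrightarrow> \<bar>q x - q y\<bar> \<le> A / (- ln (norm (x - y))))"

section \<open>Variable exponent Lebesgue spaces\<close>

definition modular :: "'a::euclidean_space set \<Rightarrow> ('a \<Rightarrow> real) \<Rightarrow> ('a \<Rightarrow> real) \<Rightarrow> ennreal" where
  "modular U p f = (\<integral>\<^sup>+x. ennreal (\<bar>f x\<bar> powr p x) \<partial>lebesgue_on U)"

definition Lvar :: "'a::euclidean_space set \<Rightarrow> ('a \<Rightarrow> real) \<Rightarrow> ('a \<Rightarrow> real) set" where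
  "Lvar U p = {f \<in> borel_measurable (lebesgue_on U). \<exists>l>0. modular U p (\<lambda>x. f x / l) < \<infinity>}"

definition Lvar_norm :: "'a::euclidean_space set \<Rightarrow> ('a \<Rightarrow> real) \<Rightarrow> ('a \<Rightarrow> real) \<Rightarrow> real" where
  "Lvar_norm U p f = Inf {l. 0 < l \<and> modular U p (\<lambda>x. f x / l) \<le> 1}"

section \<open>The unit sphere and homogeneous functions of degree zero\<close>

text \<open>Surface measure on the unit sphere, via polar coordinates: the measure of a Borel set
  \<open>E\<close> of the sphere is \<open>n\<close> times the volume of the cone \<open>{t x | 0 < t < 1, x \<in> E}\<close> over it,
  and this measure is then completed. In dimension one it is the counting measure on \<open>{-1, 1}\<close>.
  Here \<open>sgn x = x / norm x\<close>.\<close>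

definition sphere_measure :: "'a::euclidean_space measure" where
  "sphere_measure = completion (scale_measure (of_nat DIM('a))
     (distr (restrict_space lborel (ball 0 1 - {0})) (restrict_space borel (sphere 0 1)) sgn))"

lemma sgn_measurable_sphere:
  "sgn \<in> restrict_space lborel (ball 0 1 - {0}) \<rightarrow>\<^sub>M restrict_space borel (sphere (0::'a::euclidean_space) 1)"
proof (rule measurable_restrict_space2)
  show "sgn \<in> space (restrict_space lborel (ball 0 1 - {0})) \<rightarrow> sphere (0::'a) 1"
    by (auto simp: space_restrict_space norm_sgn)
  have "continuous_on (ball 0 1 - {0}) (sgn :: 'a \<Rightarrow> 'a)"
    unfolding sgn_div_norm by (intro continuous_intros) auto
  then have "sgn \<in> restrict_space borel (ball 0 1 - {0}) \<rightarrow>\<^sub>M (borel :: 'a measure)"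
    by (rule borel_measurable_continuous_on_restrict)
  then show "sgn \<in> restrict_space lborel (ball 0 1 - {0}) \<rightarrow>\<^sub>M (borel :: 'a measure)"
    by (simp add: measurable_cong_sets[OF sets_restrict_space_cong[OF sets_lborel] refl])
qed

lemma emeasure_sphere_measure:
  fixes E :: "'a::euclidean_space set"
  assumes E: "E \<in> sets borel" "E \<subseteq> sphere 0 1"
  shows "emeasure sphere_measure E =
    of_nat DIM('a) * emeasure lborel {x \<in> ball 0 1 - {0}. sgn x \<in> E}"
proof -
  have 1: "E \<in> sets (restrict_space borel (sphere 0 1))"
    using E by (auto simp: sets_restrict_space_iff)
  have 2: "sgn -` E \<inter> space (restrict_space lborel (ball 0 1 - {0})) = {x \<in> ball 0 1 - {0}. sgn x \<in> E}"
    by (auto simp: space_restrict_space)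
  have 3: "emeasure (restrict_space lborel (ball 0 1 - {0})) {x \<in> ball 0 1 - {0}. sgn x \<in> E} =
      emeasure lborel {x \<in> ball 0 1 - {0}. sgn x \<in> E}"
    by (rule emeasure_restrict_space) auto
  have "emeasure sphere_measure E = of_nat DIM('a) *
      emeasure (distr (restrict_space lborel (ball 0 1 - {0})) (restrict_space borel (sphere 0 1)) sgn) E"
    unfolding sphere_measure_def using 1 by (subst emeasure_completion) auto
  then show ?thesis
    using 1 2 3 by (simp add: emeasure_distr[OF sgn_measurable_sphere])
qed

text \<open>A function on \<open>\<real>\<^sup>n\<close> without the origin that is homogeneous of degree zero and whose
  restriction to the unit sphere is in \<open>L\<^sup>s\<close>; its value at the origin is irrelevant.\<close>

definition homogeneous_Ls :: "real \<Rightarrow> ('a::euclidean_space \<Rightarrow> real) set" where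
  "homogeneous_Ls s = {\<Omega>. (\<forall>t>0. \<forall>x. x \<noteq> 0 \<longrightarrow> \<Omega> (t *\<^sub>R x) = \<Omega> x) \<and>
     \<Omega> \<in> borel_measurable sphere_measure \<and> (\<integral>\<^sup>+x. ennreal (\<bar>\<Omega> x\<bar> powr s) \<partial>sphere_measure) < \<infinity>}"

section \<open>The fractional integral operator with rough kernel\<close>

definition frac_integrand ::
    "'a::euclidean_space set \<Rightarrow> ('a \<Rightarrow> real) \<Rightarrow> ('a \<Rightarrow> real) \<Rightarrow> ('a \<Rightarrow> real) \<Rightarrow> 'a \<Rightarrow> 'a \<Rightarrow> real" where
  "frac_integrand U \<Omega> \<alpha> f x y =
     \<Omega> (x - y) / norm (x - y) powr (real DIM('a) - \<alpha> x) * (if y \<in> U then f y else 0)"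

definition frac_integral ::
    "'a::euclidean_space set \<Rightarrow> ('a \<Rightarrow> real) \<Rightarrow> ('a \<Rightarrow> real) \<Rightarrow> ('a \<Rightarrow> real) \<Rightarrow> 'a \<Rightarrow> real" where
  "frac_integral U \<Omega> \<alpha> f x = (LINT y|lebesgue. frac_integrand U \<Omega> \<alpha> f x y)"

section \<open>The interval of admissible summation exponents\<close>

definition I_interval :: "ereal \<Rightarrow> ereal \<Rightarrow> ereal set" where
  "I_interval p q =
     (if p < q \<and> q < 2 then {q<..2}
      else if 2 < p \<and> p < q then {2..<p}
      else {min 2 q..max 2 p})"

definition lr_sum :: "real \<Rightarrow> nat \<Rightarrow> (nat \<Rightarrow> 'a \<Rightarrow> real) \<Rightarrow> 'a \<Rightarrow> real" where
  "lr_sum r N g x = (\<Sum>k=1..N. \<bar>g k x\<bar> powr r) powr (1 / r)"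

end

theory Submission
  imports Defs
begin

text \<open>
  Minkowski's inequality replaces the sum over \<open>k\<close> by the single function
  \<open>h = (\<Sum>\<^sub>k |f\<^sub>k|\<^sup>r)\<^sup>1\<^sup>/\<^sup>r\<close> under the positive kernel \<open>|\<Omega>|\<close>, so only a scalar bound for
  \<open>h \<ge> 0\<close> with \<open>\<integral> \<Phi> \<le> 1\<close>, \<open>\<Phi> = h\<^sup>q\<close>, is needed. No maximal function is used. Put \<open>m = s'\<close>, so that
  \<open>m \<le> q\<close> almost everywhere, \<open>\<omega> = max 1 |\<Omega>|\<close>, and let
  \<open>\<kappa>\<^sub>l(z) = |z|\<^sup>-\<^sup>n min(l|z|, 1/(l|z|))\<^sup>\<eta>\<close> for a small \<open>\<eta> > 0\<close>. By homogeneity \<open>\<integral> \<omega>\<^sup>s \<kappa>\<^sub>l\<close> is bounded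
  uniformly in \<open>l\<close>, hence by Tonelli the function
  \<open>R(x) = 1 + \<integral> \<omega>\<^sup>s(x - y) \<Phi>(y) \<kappa>\<^sub>l(x - y) dy\<close> with \<open>l = \<Phi>(y)\<^sup>1\<^sup>/\<^sup>n\<close> is integrable over \<open>U\<close>. The pointwise
  estimate of Hedberg type is \<open>I\<^sup>\<alpha> h \<le> C R\<^sup>1\<^sup>/\<^sup>p\<close>. It follows by integrating an elementary inequality for
  the integrand: split \<open>h(y)\<close> at a level \<open>T\<close> with \<open>1 \<le> T \<le> |x - y|\<^sup>-\<^sup>n\<close>, where the log-condition permits
  to replace \<open>q(y)\<close> by \<open>q(x)\<close>, taking \<open>T = R\<^sup>1\<^sup>/\<^sup>q\<close> for \<open>|x - y| \<le> R\<^sup>-\<^sup>1\<^sup>/\<^sup>n\<close> and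
  \<open>T = |x - y|\<^sup>-\<^sup>n\<^sup>/\<^sup>q\<close> beyond.
\<close>

section \<open>Pointwise estimates of the kernel\<close>

text \<open>At \<open>t = 0\<close> this is \<open>0\<close>, because \<open>1 / 0 = 0\<close>; it occurs below where \<open>\<Phi>(y) = 0\<close>.\<close>

definition damped :: "real \<Rightarrow> real \<Rightarrow> real" where
  "damped \<eta> t = min t (1 / t) powr \<eta>"

lemma damped_nonneg [simp]: "0 \<le> damped \<eta> t"
  by (simp add: damped_def)

lemma damped_le_one: "0 < t \<Longrightarrow> t \<le> 1 \<Longrightarrow> damped \<eta> t = t powr \<eta>"
proof -
  assume "0 < t" "t \<le> 1"
  then have "t \<le> 1 / t" by (simp add: field_simps mult_le_one)
  then show ?thesis by (simp add: damped_def min_def)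
qed

lemma damped_ge_one: "1 \<le> t \<Longrightarrow> damped \<eta> t = t powr (- \<eta>)"
proof -
  assume t: "1 \<le> t"
  have "1 / t \<le> 1" "1 \<le> t" using t by auto
  then have "1 / t \<le> t" by linarith
  then show ?thesis
    by (simp add: damped_def min_absorb2 powr_minus_divide powr_divide)
qed

lemma Young_conjugate:
  fixes a b m s :: real
  assumes "1 < m" "1 < s" "1 / m + 1 / s = 1" "0 \<le> a" "0 \<le> b"
  shows "a * b \<le> a powr m + b powr s"
proof -
  have "a * b \<le> a powr m / m + b powr s / s"
    by (rule Youngs_inequality) (use assms in auto)
  also have "a powr m / m \<le> a powr m / 1"
    by (rule divide_left_mono) (use assms in auto)
  also have "b powr s / s \<le> b powr s / 1"
    by (rule divide_left_mono) (use assms in auto)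
  finally show ?thesis by simp
qed

text \<open>With \<open>t = \<phi> powr (1 / n) * \<rho>\<close>, both sides consist of exponentials
  of linear forms in ln t and ln \<rho>. For t \<ge> 1, \<phi>^(1/m) is \<phi> times (t /
  \<rho>)^(-n/s), and n/s \<ge> \<eta> yields the decay t^(-\<eta>). For t < 1, either the left side
  is at most \<rho>^\<eta>, or \<phi> \<ge> 1; then \<rho> \<le> t, so that \<rho>^a \<le>
  \<rho>^\<eta> \<le> t^\<eta> and \<phi>^(1/m) \<le> \<phi>.\<close>

lemma near_term_bound:
  fixes n a m s \<eta> \<phi> \<rho> :: real
  assumes "0 < n" "1 < m" "1 < s" "1 / m + 1 / s = 1"
    and "0 < \<eta>" "\<eta> \<le> a" "\<eta> \<le> n / s" and "0 \<le> \<phi>" "0 < \<rho>" "\<rho> \<le> 1"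
  shows "\<rho> powr a * \<phi> powr (1 / m) \<le> \<phi> * damped \<eta> (\<phi> powr (1 / n) * \<rho>) + \<rho> powr \<eta>"
proof (cases "\<phi> = 0")
  case False
  then have \<phi>: "0 < \<phi>" using assms by simp
  define L where "L = ln \<rho>"
  define t where "t = \<phi> powr (1 / n) * \<rho>"
  define T where "T = ln t"
  have t: "0 < t" using \<phi> assms by (simp add: t_def)
  have L: "L \<le> 0" using assms by (simp add: L_def)
  have "T = ln \<phi> / n + L"
    using \<phi> assms by (simp add: T_def t_def L_def ln_mult)
  then have ln\<phi>: "ln \<phi> = n * (T - L)" using assms by (simp add: field_simps)
  have lhs: "\<rho> powr a * \<phi> powr (1 / m) = exp (a * L + n * (T - L) / m)"
    using \<phi> assms by (simp add: powr_def ln\<phi> L_def exp_add)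
  have m: "1 / m = 1 - 1 / s" using assms(4) by linarith
  have expand: "n * (T - L) / m = n * (T - L) - n * (T - L) / s"
  proof -
    have "n * (T - L) * (1 / m) = n * (T - L) * (1 - 1 / s)" using m by simp
    then show ?thesis by (simp add: right_diff_distrib)
  qed
  show ?thesis
  proof (cases "1 \<le> t")
    case True
    then have T: "0 \<le> T" by (simp add: T_def)
    have "a * L \<le> 0" using L assms by (simp add: mult_nonneg_nonpos)
    moreover have "n * L / s \<le> 0" using L assms by (simp add: divide_nonpos_pos mult_nonneg_nonpos)
    moreover have "\<eta> * T \<le> n / s * T" using T assms by (intro mult_right_mono) auto
    ultimately have "a * L + n * (T - L) / m \<le> n * (T - L) - \<eta> * T"
      unfolding expand by (simp add: algebra_simps diff_divide_distrib)
    then have "\<rho> powr a * \<phi> powr (1 / m) \<le> exp (n * (T - L) - \<eta> * T)"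
      unfolding lhs by simp
    also have "\<dots> = exp (n * (T - L)) * exp (- \<eta> * T)" by (simp flip: exp_add)
    also have "\<dots> = \<phi> * damped \<eta> t"
    proof -
      have "exp (n * (T - L)) = \<phi>" using \<phi> by (simp flip: ln\<phi>)
      moreover have "exp (- \<eta> * T) = damped \<eta> t" using True t by (simp add: damped_ge_one powr_def T_def)
      ultimately show ?thesis by simp
    qed
    finally show ?thesis unfolding t_def by (smt (verit) powr_ge_zero)
  next
    case False
    then have T: "T < 0" using t by (simp add: T_def)
    show ?thesis
    proof (cases "a * L + n * (T - L) / m \<le> \<eta> * L")
      case True
      then have "\<rho> powr a * \<phi> powr (1 / m) \<le> \<rho> powr \<eta>"
        unfolding lhs using assms by (simp add: powr_def L_def)
      then show ?thesis using \<phi> by (smt (verit) damped_nonneg mult_nonneg_nonneg)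
    next
      case False
      \<comment> \<open>Failure of the first alternative means \<phi>^(1/m) > \<rho>^(\<eta> - a)
        \<ge> 1, since \<rho> \<le> 1 and \<eta> \<le> a. Hence ln \<phi> \<ge> 0, which is T \<ge>
        L.\<close>
      have "n * (T - L) / m > (\<eta> - a) * L" using False by (simp add: algebra_simps)
      then have g: "n * (T - L) > m * (\<eta> - a) * L" using assms by (simp add: field_simps)
      have c: "0 \<le> (\<eta> - a) * L" using L assms by (simp add: mult_nonpos_nonpos)
      have e1: "n * (T - L) / s \<ge> 0"
        using g c assms by (smt (verit) mult.assoc mult_nonneg_nonneg divide_nonneg_pos)
      then have "n * (T - L) \<ge> 0" using assms by (simp add: field_simps)
      then have "T \<ge> L" using assms by (simp add: zero_le_mult_iff)
      then have "\<eta> * L \<le> \<eta> * T" using assms by (intro mult_left_mono) auto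
      moreover have "a * L \<le> \<eta> * L" using L assms by (intro mult_right_mono_neg) auto
      ultimately have "a * L + n * (T - L) / m \<le> n * (T - L) + \<eta> * T"
        unfolding expand using e1 by linarith
      then have "\<rho> powr a * \<phi> powr (1 / m) \<le> exp (n * (T - L) + \<eta> * T)"
        unfolding lhs by simp
      also have "\<dots> = \<phi> * damped \<eta> t"
      proof -
        have "exp (n * (T - L)) = \<phi>" using \<phi> by (simp flip: ln\<phi>)
        moreover have "exp (\<eta> * T) = damped \<eta> t"
          using \<open>\<not> 1 \<le> t\<close> t by (simp add: damped_le_one powr_def T_def)
        ultimately show ?thesis by (simp add: exp_add)
      qed
      finally show ?thesis unfolding t_def by (smt (verit) powr_ge_zero)
    qed
  qed
qed simp

text \<open>Above the level, r \<ge> m gives f \<le> T (f / T)^(r/m) = T^(1 - r/m) f^(r/m). Here q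
  is the exponent at x and r the one at y; the log-condition exchanges r for q at the bounded cost
  T^((q - r)/m) \<le> exp(n A / m), provided that T \<le> z^(-n).\<close>

lemma split_at_level:
  fixes f T z m n A q r :: real
  assumes "0 \<le> f" "1 \<le> T" "T \<le> z powr (- n)" "0 < z" "z \<le> 1 / 2" "0 < m" "m \<le> r" "0 \<le> A" "0 \<le> n"
    and "\<bar>q - r\<bar> \<le> A / (- ln z)"
  shows "f \<le> T + exp (n * A / m) * (T powr (1 - q / m) * (f powr r) powr (1 / m))"
proof (cases "f \<le> T")
  case True
  then show ?thesis by (smt (verit) exp_ge_zero mult_nonneg_nonneg powr_ge_zero)
next
  case False
  then have f: "T < f" "0 < f" using assms by auto
  have lnz: "ln z < 0" using assms by simp
  have "ln T \<le> ln (z powr (- n))" using assms by (subst ln_le_cancel_iff) auto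
  then have lnT: "ln T \<le> n * (- ln z)" "0 \<le> ln T" using assms by auto
  \<comment> \<open>The growth of ln T, at most n times -ln z, cancels the -ln z in the modulus of
    continuity.\<close>
  have "ln T * (q - r) \<le> ln T * (A / (- ln z))" using assms lnT by (intro mult_left_mono) auto
  also have "\<dots> \<le> (n * (- ln z)) * (A / (- ln z))" using lnT lnz assms by (intro mult_right_mono) (auto simp: divide_nonneg_neg)
  also have "\<dots> = n * A" using lnz by simp
  finally have d: "ln T * (q - r) \<le> n * A" .
  have "0 \<le> (ln f - ln T) * (r - m)" using f assms by (intro mult_nonneg_nonneg) auto
  then have "m * ln f \<le> n * A + (m - q) * ln T + r * ln f"
    using d by (simp add: algebra_simps)
  then have "ln f \<le> (n * A + (m - q) * ln T + r * ln f) / m"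
    using assms by (simp add: field_simps)
  also have "\<dots> = n * A / m + (1 - q / m) * ln T + r * (1 / m) * ln f"
    using assms by (simp add: field_simps)
  finally have "exp (ln f) \<le> exp (n * A / m + (1 - q / m) * ln T + r * (1 / m) * ln f)" by simp
  then have "f \<le> exp (n * A / m) * (T powr (1 - q / m) * (f powr r) powr (1 / m))"
    using f assms by (simp add: powr_def exp_add mult_ac)
  then show ?thesis using assms by linarith
qed

text \<open>In the application z = |x - y|, q = q(x), r = q(y), f = h(y) and \<omega> = \<omega>(x -
  y). The bracket on the right is the integrand of the potential divided by R, plus \<Phi>(y), plus
  \<omega>^s times a damped kernel of scale R^(1/n). As functions of y all three have integrals
  bounded independently of R once R dominates the potential at x.\<close>

lemma kernel_pointwise_near:
  fixes n \<alpha> m s \<eta> \<omega> z q r p R f A :: real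
  assumes n: "0 < n" and m: "1 < m" "1 < s" "1 / m + 1 / s = 1"
    and \<eta>: "0 < \<eta>" "\<eta> \<le> \<alpha>" "\<eta> \<le> n / s" "\<eta> \<le> n / p"
    and \<omega>: "1 \<le> \<omega>" and z: "0 < z" "z \<le> 1 / 2"
    and q: "1 \<le> q" "m \<le> r" "1 / p = 1 / q - \<alpha> / n" and A: "0 \<le> A" "\<bar>q - r\<bar> \<le> A / (- ln z)"
    and R: "1 \<le> R" and f: "0 \<le> f"
  shows "\<omega> * z powr (\<alpha> - n) * f \<le> (1 + exp (n * A / m)) * (R powr (1 / p) *
    (\<omega> powr s * f powr r * z powr (- n) * damped \<eta> ((f powr r) powr (1 / n) * z) / R + f powr r
      + \<omega> powr s * z powr (- n) * damped \<eta> (R powr (1 / n) * z)))"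
proof -
  define \<Phi> where "\<Phi> = f powr r"
  define \<rho> where "\<rho> = R powr (1 / n) * z"
  define E where "E = exp (n * A / m)"
  define D1 where "D1 = \<omega> powr s * \<Phi> * z powr (- n) * damped \<eta> (\<Phi> powr (1 / n) * z) / R"
  define D3 where "D3 = \<omega> powr s * z powr (- n) * damped \<eta> \<rho>"
  have E: "0 < E" by (simp add: E_def)
  have \<Phi>0: "0 \<le> \<Phi>" by (simp add: \<Phi>_def)
  have \<rho>: "0 < \<rho>" using R z by (simp add: \<rho>_def)
  have D: "0 \<le> D1" "0 \<le> D3" "0 \<le> \<Phi>" using R by (auto simp: D1_def D3_def \<Phi>_def)
  have \<omega>s: "\<omega> \<le> \<omega> powr s" using \<omega> m powr_mono[of 1 s \<omega>] by simp
  have \<omega>s0: "0 < \<omega> powr s" using \<omega> by simp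
  have p': "1 / q = 1 / p + \<alpha> / n" using q by simp
  have L: "ln \<rho> = ln R / n + ln z" using R z by (simp add: \<rho>_def ln_mult)
  \<comment> \<open>The level has to control both terms that \<open>split_at_level\<close> produces;
    its choice depends on whether z is below R^(-1/n), that is, on \<rho> \<le> 1.\<close>
  have key: "\<exists>T. 1 \<le> T \<and> T \<le> z powr (- n) \<and> \<omega> * z powr (\<alpha> - n) * T \<le> R powr (1 / p) * D3 \<and>
     \<omega> * z powr (\<alpha> - n) * (T powr (1 - q / m) * \<Phi> powr (1 / m)) \<le> R powr (1 / p) * (D1 + \<Phi> + D3)"
  proof (cases "\<rho> \<le> 1")
    case True
    \<comment> \<open>This level satisfies T \<le> z^(-n), because \<rho> \<le> 1 says R \<le>
      z^(-n) and q \<ge> 1. It turns z^(\<alpha> - n) T into R^(1/p) z^(-n) \<rho>^\<alpha>.\<close>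
    define T where "T = R powr (1 / q)"
    have lnR: "ln R \<le> - n * ln z"
    proof -
      have "ln \<rho> \<le> 0" using True \<rho> by simp
      then show ?thesis unfolding L using n by (simp add: field_simps)
    qed
    have lnR0: "0 \<le> ln R" using R by simp
    have T1: "1 \<le> T" using R q by (simp add: T_def ge_one_powr_ge_zero)
    have "ln R * (1 / q) \<le> ln R * 1" using lnR0 q by (intro mult_left_mono) auto
    then have T2: "T \<le> z powr (- n)" using R z lnR by (simp add: T_def powr_def)
    have "z powr (\<alpha> - n) * T = R powr (1 / p) * z powr (- n) * \<rho> powr \<alpha>"
    proof -
      have "(\<alpha> - n) * ln z + 1 / q * ln R = 1 / p * ln R + - n * ln z + \<alpha> * ln \<rho>"
        unfolding p' L using n by (simp add: field_simps)
      then show ?thesis using R z \<rho> by (simp add: T_def powr_def flip: exp_add)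
    qed
    then have "\<omega> * z powr (\<alpha> - n) * T = R powr (1 / p) * (\<omega> * z powr (- n) * \<rho> powr \<alpha>)" by simp
    also have "\<dots> \<le> R powr (1 / p) * (\<omega> powr s * z powr (- n) * \<rho> powr \<eta>)"
      using \<omega>s \<omega> \<eta> \<rho> True by (intro mult_left_mono mult_mono powr_mono'[of \<eta> \<alpha> \<rho>]) auto
    also have "\<dots> = R powr (1 / p) * D3" using True \<rho> by (simp add: D3_def damped_le_one)
    finally have T3: "\<omega> * z powr (\<alpha> - n) * T \<le> R powr (1 / p) * D3" .
    have "z powr (\<alpha> - n) * (T powr (1 - q / m)) = R powr (1 / p) * z powr (- n) * \<rho> powr \<alpha> * R powr (- 1 / m)"
    proof -
      have "(\<alpha> - n) * ln z + (1 / q) * (1 - q / m) * ln R = 1 / p * ln R + - n * ln z + \<alpha> * ln \<rho> + (- 1 / m) * ln R"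
      proof -
        have "(1 / q) * (1 - q / m) = 1 / p + \<alpha> / n - 1 / m" unfolding p'[symmetric] using q m by (simp add: field_simps)
        then have "(1 / q) * (1 - q / m) * ln R = (1 / p + \<alpha> / n - 1 / m) * ln R" by (rule arg_cong)
        then show ?thesis unfolding L using n by (simp add: algebra_simps)
      qed
      then show ?thesis using R z \<rho> by (simp add: T_def powr_powr powr_def flip: exp_add)
    qed
    note zTm = this
    have \<Phi>R: "(\<Phi> / R) powr (1 / m) = R powr (- 1 / m) * \<Phi> powr (1 / m)"
      using powr_minus_divide[of R "1 / m"] by (simp add: powr_divide)
    have "\<omega> * z powr (\<alpha> - n) * (T powr (1 - q / m) * \<Phi> powr (1 / m))
       = \<omega> * (z powr (\<alpha> - n) * (T powr (1 - q / m))) * \<Phi> powr (1 / m)" by (simp only: mult_ac)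
    also have "\<dots> = R powr (1 / p) * z powr (- n) * \<omega> * (\<rho> powr \<alpha> * (\<Phi> / R) powr (1 / m))"
      unfolding zTm \<Phi>R by (simp only: mult_ac)
    also have "\<dots> \<le> R powr (1 / p) * z powr (- n) * \<omega> powr s * (\<rho> powr \<alpha> * (\<Phi> / R) powr (1 / m))"
      using \<omega>s by (intro mult_right_mono mult_left_mono) auto
    \<comment> \<open>\<open>near_term_bound\<close> is applied to \<Phi> / R instead of \<Phi>:
      since (\<Phi> / R)^(1/n) \<rho> = \<Phi>^(1/n) z, the resulting damping has a scale depending
      on y alone.\<close>
    also have "\<dots> \<le> R powr (1 / p) * z powr (- n) * \<omega> powr s *
        (\<Phi> / R * damped \<eta> ((\<Phi> / R) powr (1 / n) * \<rho>) + \<rho> powr \<eta>)"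
      using near_term_bound[OF n m \<eta>(1-3), of "\<Phi> / R" \<rho>] True \<rho> \<Phi>0 R
      by (intro mult_left_mono) auto
    also have "(\<Phi> / R) powr (1 / n) * \<rho> = \<Phi> powr (1 / n) * z"
      using R by (simp add: \<rho>_def powr_divide)
    also have "\<rho> powr \<eta> = damped \<eta> \<rho>" using True \<rho> by (simp add: damped_le_one)
    also have "R powr (1 / p) * z powr (- n) * \<omega> powr s * (\<Phi> / R * damped \<eta> (\<Phi> powr (1 / n) * z) + damped \<eta> \<rho>)
      = R powr (1 / p) * (D1 + D3)"
      by (simp add: D1_def D3_def algebra_simps)
    also have "\<dots> \<le> R powr (1 / p) * (D1 + \<Phi> + D3)" using D by (intro mult_left_mono) auto
    finally have T4: "\<omega> * z powr (\<alpha> - n) * (T powr (1 - q / m) * \<Phi> powr (1 / m)) \<le> R powr (1 / p) * (D1 + \<Phi> + D3)" .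
    show ?thesis using T1 T2 T3 T4 by blast
  next
    case False
    then have \<rho>1: "1 \<le> \<rho>" by simp
    \<comment> \<open>The exponent is chosen to make z^(\<alpha> - n) T equal to R^(1/p) z^(-n)
      \<rho>^(-n/p), which decays in \<rho> \<ge> 1 at least like \<rho>^(-\<eta>).\<close>
    define T where "T = z powr (- n / q)"
    have lnz: "ln z < 0" using z by simp
    have "0 \<le> (- n / q) * ln z" using n q lnz by (intro mult_nonpos_nonpos) auto
    then have T1: "1 \<le> T" using z by (simp add: T_def powr_def)
    have "z powr (- n / q) \<le> z powr (- n)"
      using z n q by (intro powr_mono') (auto simp: field_simps)
    then have T2: "T \<le> z powr (- n)" by (simp add: T_def)
    have "z powr (\<alpha> - n) * T = R powr (1 / p) * z powr (- n) * \<rho> powr (- n / p)"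
    proof -
      have "(\<alpha> - n) + - n / q = - n - n / p"
      proof -
        have "n * (1 / q) = n * (1 / p + \<alpha> / n)" using p' by simp
        then show ?thesis using n by (simp add: algebra_simps)
      qed
      then have "(\<alpha> - n) * ln z + - n / q * ln z = (- n - n / p) * ln z"
        by (metis distrib_right)
      also have "\<dots> = 1 / p * ln R + - n * ln z + - n / p * ln \<rho>"
        unfolding L using n by (simp add: algebra_simps)
      finally show ?thesis using R z \<rho> by (simp add: T_def powr_def flip: exp_add)
    qed
    note zT = this
    have "\<omega> * z powr (\<alpha> - n) * T = R powr (1 / p) * (\<omega> * z powr (- n) * \<rho> powr (- n / p))"
      using zT by simp
    also have "\<dots> \<le> R powr (1 / p) * (\<omega> powr s * z powr (- n) * \<rho> powr (- \<eta>))"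
      using \<omega>s \<omega> \<eta> \<rho>1 by (intro mult_left_mono mult_mono powr_mono[of "- n / p" "- \<eta>" \<rho>]) auto
    also have "\<dots> = R powr (1 / p) * D3" using \<rho>1 by (simp add: D3_def damped_ge_one)
    finally have T3: "\<omega> * z powr (\<alpha> - n) * T \<le> R powr (1 / p) * D3" .
    have Tm: "T powr (1 - q / m) = T * z powr (n / m)"
    proof -
      have "- n / q * (1 - q / m) = - n / q + n / m" using q by (simp add: field_simps)
      then show ?thesis by (simp add: T_def powr_powr flip: powr_add)
    qed
    have "\<omega> * z powr (\<alpha> - n) * (T powr (1 - q / m) * \<Phi> powr (1 / m))
       = R powr (1 / p) * z powr (- n) * ((\<Phi> powr (1 / m) * z powr (n / m)) * (\<omega> * \<rho> powr (- n / p)))"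
      using zT by (simp add: Tm mult_ac)
    \<comment> \<open>Young's inequality separates \<Phi> from \<omega>. The factor z^(n/m) is
      grouped with \<Phi>^(1/m) so that its power z^n cancels z^(-n) and leaves \<Phi>
      itself.\<close>
    also have "\<dots> \<le> R powr (1 / p) * z powr (- n) * ((\<Phi> powr (1 / m) * z powr (n / m)) powr m + (\<omega> * \<rho> powr (- n / p)) powr s)"
      using m \<omega> by (intro mult_left_mono Young_conjugate) auto
    also have "(\<Phi> powr (1 / m) * z powr (n / m)) powr m = \<Phi> * z powr n"
      using m \<Phi>0 by (simp add: powr_mult powr_powr)
    also have "(\<omega> * \<rho> powr (- n / p)) powr s = \<omega> powr s * \<rho> powr (- n / p * s)"
      by (simp add: powr_mult powr_powr)
    also have "R powr (1 / p) * z powr (- n) * (\<Phi> * z powr n + \<omega> powr s * \<rho> powr (- n / p * s))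
       = R powr (1 / p) * (\<Phi> + \<omega> powr s * z powr (- n) * \<rho> powr (- n / p * s))"
    proof -
      have "z powr (- n) * z powr n = 1" using z by (simp flip: powr_add)
      then show ?thesis by (simp add: algebra_simps)
    qed
    also have "\<dots> \<le> R powr (1 / p) * (\<Phi> + \<omega> powr s * z powr (- n) * \<rho> powr (- \<eta>))"
    proof -
      have "\<eta> * 1 \<le> n / p * s" using \<eta> m by (intro mult_mono) auto
      then show ?thesis using \<rho>1 by (intro mult_left_mono add_left_mono powr_mono) auto
    qed
    also have "\<dots> = R powr (1 / p) * (\<Phi> + D3)" using \<rho>1 by (simp add: D3_def damped_ge_one)
    also have "\<dots> \<le> R powr (1 / p) * (D1 + \<Phi> + D3)" using D by (intro mult_left_mono) auto
    finally have T4: "\<omega> * z powr (\<alpha> - n) * (T powr (1 - q / m) * \<Phi> powr (1 / m)) \<le> R powr (1 / p) * (D1 + \<Phi> + D3)" .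
    show ?thesis using T1 T2 T3 T4 by blast
  qed
  then obtain T where T: "1 \<le> T" "T \<le> z powr (- n)" "\<omega> * z powr (\<alpha> - n) * T \<le> R powr (1 / p) * D3"
     "\<omega> * z powr (\<alpha> - n) * (T powr (1 - q / m) * \<Phi> powr (1 / m)) \<le> R powr (1 / p) * (D1 + \<Phi> + D3)"
    by blast
  have "f \<le> T + E * (T powr (1 - q / m) * \<Phi> powr (1 / m))"
    unfolding E_def \<Phi>_def using f T z m q A n by (intro split_at_level) auto
  then have "\<omega> * z powr (\<alpha> - n) * f \<le> \<omega> * z powr (\<alpha> - n) * (T + E * (T powr (1 - q / m) * \<Phi> powr (1 / m)))"
    using \<omega> by (intro mult_left_mono) auto
  also have "\<dots> = \<omega> * z powr (\<alpha> - n) * T + E * (\<omega> * z powr (\<alpha> - n) * (T powr (1 - q / m) * \<Phi> powr (1 / m)))"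
    by (simp add: algebra_simps)
  also have "\<dots> \<le> R powr (1 / p) * D3 + E * (R powr (1 / p) * (D1 + \<Phi> + D3))"
    using T E by (intro add_mono mult_left_mono) auto
  also have "\<dots> \<le> R powr (1 / p) * (D1 + \<Phi> + D3) + E * (R powr (1 / p) * (D1 + \<Phi> + D3))"
    using D by (intro add_right_mono mult_left_mono) auto
  also have "\<dots> = (1 + E) * (R powr (1 / p) * (D1 + \<Phi> + D3))" by (simp add: algebra_simps)
  finally show ?thesis unfolding D1_def D3_def E_def \<Phi>_def \<rho>_def .
qed

section \<open>Integrals of homogeneous functions against the damped kernel\<close>

text \<open>For l > 0 this is the dilate l^n \<kappa>(l z) of the kernel \<kappa> of scale 1, so its
  integral against a function homogeneous of degree zero does not depend on l.\<close>

definition damped_kernel :: "real \<Rightarrow> real \<Rightarrow> 'a::euclidean_space \<Rightarrow> real" where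
  "damped_kernel \<eta> l z = norm z powr (- real DIM('a)) * damped \<eta> (l * norm z)"

lemma measurable_damped [measurable]:
  "f \<in> borel_measurable M \<Longrightarrow> (\<lambda>x. damped \<eta> (f x)) \<in> borel_measurable M"
  unfolding damped_def by measurable

lemma measurable_damped_kernel [measurable]:
  fixes g :: "'b \<Rightarrow> 'a::euclidean_space"
  assumes [measurable]: "l \<in> borel_measurable M" "g \<in> borel_measurable M"
  shows "(\<lambda>x. damped_kernel \<eta> (l x) (g x)) \<in> borel_measurable M"
  unfolding damped_kernel_def by measurable

lemma damped_kernel_nonneg [simp]: "0 \<le> damped_kernel \<eta> l z"
  by (simp add: damped_kernel_def)

section \<open>Affine changes of variable for Lebesgue measure\<close>

lemma nn_integral_lborel_affine:
  fixes f :: "'a::euclidean_space \<Rightarrow> ennreal"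
  assumes [measurable]: "f \<in> borel_measurable borel" and c: "c \<noteq> 0"
  shows "(\<integral>\<^sup>+x. f x \<partial>lborel) = \<bar>c\<bar> ^ DIM('a) * (\<integral>\<^sup>+x. f (t + c *\<^sub>R x) \<partial>lborel)"
  by (subst lborel_affine[OF c, of t])
     (simp add: nn_integral_density nn_integral_distr nn_integral_cmult ennreal_power)

lemma nn_integral_lborel_translate:
  fixes f :: "'a::euclidean_space \<Rightarrow> ennreal"
  assumes [measurable]: "f \<in> borel_measurable borel"
  shows "(\<integral>\<^sup>+x. f (x - y) \<partial>lborel) = (\<integral>\<^sup>+x. f x \<partial>lborel)"
  using nn_integral_lborel_affine[of f 1 "- y"] by simp

lemma nn_integral_lborel_reflect:
  fixes f :: "'a::euclidean_space \<Rightarrow> ennreal"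
  assumes [measurable]: "f \<in> borel_measurable borel"
  shows "(\<integral>\<^sup>+y. f (x - y) \<partial>lborel) = (\<integral>\<^sup>+y. f y \<partial>lborel)"
  using nn_integral_lborel_affine[of f "-1" x] by simp

lemma AE_lborel_affine:
  fixes P :: "'a::euclidean_space \<Rightarrow> bool"
  assumes "AE x in lborel. P x" and c: "c \<noteq> 0"
  shows "AE x in lborel. P (t + c *\<^sub>R x)"
proof -
  obtain N where N: "\<And>x. x \<in> space lborel - N \<Longrightarrow> P x" "N \<in> null_sets lborel"
    using AE_E3[OF assms(1)] by blast
  have [measurable]: "N \<in> sets borel" using N by auto
  have "(\<integral>\<^sup>+x. indicator N x \<partial>lborel) = 0" using N by (simp add: null_setsD1)
  then have "(\<integral>\<^sup>+x. indicator N (t + c *\<^sub>R x) \<partial>lborel) = (0::ennreal)"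
    using c by (subst (asm) nn_integral_lborel_affine[of _ c t]) auto
  then have "AE x in lborel. indicator N (t + c *\<^sub>R x) = (0::ennreal)"
    by (subst (asm) nn_integral_0_iff_AE) auto
  then show ?thesis
  proof eventually_elim
    case (elim x)
    then show ?case using N by (auto simp: indicator_def split: if_splits)
  qed
qed

lemma pred_ball [measurable]: "Measurable.pred borel (\<lambda>x::'a::euclidean_space. x \<in> ball c r)"
  by (simp add: pred_def)

lemma homogeneous_integral_ball:
  fixes G :: "'a::euclidean_space \<Rightarrow> ennreal"
  assumes [measurable]: "G \<in> borel_measurable borel"
    and hom: "\<And>t x. 0 < t \<Longrightarrow> x \<noteq> 0 \<Longrightarrow> G (t *\<^sub>R x) = G x" and t: "0 < t"
  shows "(\<integral>\<^sup>+x. G x * indicator (ball 0 t) x \<partial>lborel) = ennreal (t ^ DIM('a)) * (\<integral>\<^sup>+x. G x * indicator (ball 0 1) x \<partial>lborel)"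
proof -
  have "(\<integral>\<^sup>+x. G x * indicator (ball 0 t) x \<partial>lborel) =
      ennreal (\<bar>t\<bar> ^ DIM('a)) * (\<integral>\<^sup>+x. G (0 + t *\<^sub>R x) * indicator (ball 0 t) (0 + t *\<^sub>R x) \<partial>lborel)"
    using t by (subst nn_integral_lborel_affine[of _ t 0]) (auto simp: ennreal_power)
  also have "(\<integral>\<^sup>+x. G (0 + t *\<^sub>R x) * indicator (ball 0 t) (0 + t *\<^sub>R x) \<partial>lborel) = (\<integral>\<^sup>+x. G x * indicator (ball 0 1) x \<partial>lborel)"
  proof (rule nn_integral_cong_AE)
    \<comment> \<open>Homogeneity says nothing at the origin, which is a null set.\<close>
    have "AE x in lborel. x \<noteq> (0::'a)" by (simp add: AE_lborel_singleton)
    then show "AE x in lborel. G (0 + t *\<^sub>R x) * indicator (ball 0 t) (0 + t *\<^sub>R x) = G x * indicator (ball 0 1) x"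
      by eventually_elim (use t in \<open>auto simp: hom indicator_def\<close>)
  qed
  finally show ?thesis using t by simp
qed

section \<open>Dyadic decomposition of the damped kernel\<close>

lemma dyadic_scale_exists:
  fixes u :: real
  assumes "1 \<le> u"
  shows "\<exists>j::nat. 2 ^ j \<le> u \<and> u < 2 ^ Suc j"
proof -
  define j where "j = nat \<lfloor>log 2 u\<rfloor>"
  have "0 \<le> log 2 u" using assms by simp
  then have "real j \<le> log 2 u" "log 2 u < real (Suc j)" unfolding j_def by linarith+
  then have "2 powr real j \<le> u" "u < 2 powr real (Suc j)"
    using assms by (auto simp: le_log_iff log_less_iff)
  then show ?thesis by (simp only: powr_realpow) auto
qed

text \<open>On the shell where l |z| is comparable to 2^(-j) or to 2^j, the damping is at most
  2^(-\<eta> j), while |z|^(-n) is at most (2c)^n with c the reciprocal radius of the shell. Adding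
  the two balls lets one series in j serve both small and large l |z|.\<close>

lemma damped_kernel_dyadic_bound:
  fixes z :: "'a::euclidean_space" and l \<eta> :: real
  assumes l: "0 < l" and \<eta>: "0 < \<eta>" and z: "z \<noteq> 0"
  shows "\<exists>j::nat. damped_kernel \<eta> l z \<le> 2 powr (- \<eta> * real j) *
     ((2 * (l * 2 ^ j)) ^ DIM('a) * indicator (ball 0 (2 / (l * 2 ^ j))) z +
      (2 * (l / 2 ^ j)) ^ DIM('a) * indicator (ball 0 (2 / (l / 2 ^ j))) z)"
proof -
  define r where "r = norm z"
  have r: "0 < r" using z by (simp add: r_def)
  have dk: "damped_kernel \<eta> l z = (1 / r) ^ DIM('a) * damped \<eta> (l * r)"
    using r by (simp add: damped_kernel_def r_def powr_minus_divide powr_realpow power_one_over)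
  \<comment> \<open>The constants 2 accommodate both shells: c r lies in (1/2, 1] when l r < 1 and
    in [1, 2) otherwise.\<close>
  have *: ?thesis if "damped \<eta> (l * r) \<le> 2 powr (- \<eta> * real j)" "1 / r \<le> 2 * c" "r < 2 / c" "0 < c"
    "c = l * 2 ^ j \<or> c = l / 2 ^ j" for j :: nat and c
  proof -
    have "damped_kernel \<eta> l z \<le> (2 * c) ^ DIM('a) * 2 powr (- \<eta> * real j)"
      unfolding dk using that r by (intro mult_mono power_mono) auto
    also have "\<dots> = 2 powr (- \<eta> * real j) * ((2 * c) ^ DIM('a) * indicator (ball 0 (2 / c)) z)"
      using that by (simp add: r_def)
    also have "\<dots> \<le> 2 powr (- \<eta> * real j) *
     ((2 * (l * 2 ^ j)) ^ DIM('a) * indicator (ball 0 (2 / (l * 2 ^ j))) z +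
      (2 * (l / 2 ^ j)) ^ DIM('a) * indicator (ball 0 (2 / (l / 2 ^ j))) z)"
    proof -
      define b where "b c = (2 * c) ^ DIM('a) * indicat_real (ball (0::'a) (2 / c)) z" for c :: real
      have "0 \<le> b (l * 2 ^ j)" "0 \<le> b (l / 2 ^ j)" using l by (auto simp: b_def)
      then have "b c \<le> b (l * 2 ^ j) + b (l / 2 ^ j)" using that(5) by fastforce
      then show ?thesis unfolding b_def by (intro mult_left_mono) auto
    qed
    finally show ?thesis by blast
  qed
  show ?thesis
  proof (cases "l * r < 1")
    case True
    then have "1 \<le> 1 / (l * r)" using l r by simp
    then obtain j :: nat where j: "2 ^ j \<le> 1 / (l * r)" "1 / (l * r) < 2 ^ Suc j"
      using dyadic_scale_exists by blast
    have rl: "l * r * 2 ^ j \<le> 1" "1 < l * r * 2 ^ Suc j" using j l r by (auto simp: field_simps)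
    have "damped \<eta> (l * r) = (l * r) powr \<eta>" using True l r by (simp add: damped_le_one)
    also have "\<dots> \<le> (1 / 2 ^ j) powr \<eta>" using rl \<eta> l r by (intro powr_mono2) (auto simp: field_simps)
    also have "\<dots> = 2 powr (- \<eta> * real j)"
      by (simp add: powr_divide powr_powr mult.commute powr_minus_divide flip: powr_realpow)
    finally show ?thesis
      using rl l r by (intro *[of j "l * 2 ^ j"]) (auto simp: field_simps)
  next
    case False
    then obtain j :: nat where j: "2 ^ j \<le> l * r" "l * r < 2 ^ Suc j"
      using dyadic_scale_exists[of "l * r"] by auto
    have "damped \<eta> (l * r) = (l * r) powr (- \<eta>)" using False by (simp add: damped_ge_one)
    also have "\<dots> \<le> (2 ^ j) powr (- \<eta>)" using j \<eta> by (intro powr_mono2') auto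
    also have "\<dots> = 2 powr (- \<eta> * real j)" by (simp add: powr_powr mult.commute flip: powr_realpow)
    finally show ?thesis
      using j l r by (intro *[of j "l / 2 ^ j"]) (auto simp: field_simps)
  qed
qed

text \<open>The dyadic bound majorises the integral by a geometric series of normalised integrals
  over balls. By homogeneity each ball contributes (2c)^n (2/c)^n = 4^n times the integral over the
  unit ball, whatever c is, which makes the bound uniform in l.\<close>

lemma homogeneous_integral_damped_kernel:
  fixes G :: "'a::euclidean_space \<Rightarrow> ennreal" and \<eta> :: real
  assumes G[measurable]: "G \<in> borel_measurable borel"
    and hom: "\<And>t x. 0 < t \<Longrightarrow> x \<noteq> 0 \<Longrightarrow> G (t *\<^sub>R x) = G x"
    and fin: "(\<integral>\<^sup>+x. G x * indicator (ball 0 1) x \<partial>lborel) < \<infinity>" and \<eta>: "0 < \<eta>"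
  shows "\<exists>K\<ge>0. \<forall>l\<ge>0. (\<integral>\<^sup>+z. G z * ennreal (damped_kernel \<eta> l z) \<partial>lborel) \<le> ennreal K"
proof -
  define B where "B = (\<integral>\<^sup>+x. G x * indicator (ball 0 1) x \<partial>lborel)"
  define W where "W c z = G z * ennreal ((2 * c) ^ DIM('a) * indicator (ball 0 (2 / c)) z)" for c z
  define S where "S = (\<Sum>j::nat. ennreal (2 powr (- \<eta> * real j)))"
  have W: "(\<integral>\<^sup>+z. W c z \<partial>lborel) = ennreal (4 ^ DIM('a)) * B" if "0 < c" for c
  proof -
    have "(\<integral>\<^sup>+z. W c z \<partial>lborel) = (\<integral>\<^sup>+z. ennreal ((2 * c) ^ DIM('a)) * (G z * indicator (ball 0 (2 / c)) z) \<partial>lborel)"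
      by (intro nn_integral_cong) (auto simp: W_def indicator_def mult.commute)
    also have "\<dots> = ennreal ((2 * c) ^ DIM('a)) * (ennreal ((2 / c) ^ DIM('a)) * B)"
      using homogeneous_integral_ball[OF G hom, of "2 / c"] that
      by (subst nn_integral_cmult) (auto simp: B_def)
    also have "\<dots> = ennreal ((2 * c) ^ DIM('a) * (2 / c) ^ DIM('a)) * B"
      using that by (simp add: ennreal_mult mult.assoc)
    also have "(2 * c) ^ DIM('a) * (2 / c) ^ DIM('a) = 4 ^ DIM('a)"
      using that by (subst power_mult_distrib[symmetric]) simp
    finally show ?thesis .
  qed
  have [measurable]: "W c \<in> borel_measurable borel" for c unfolding W_def by measurable
  have sm: "summable (\<lambda>j::nat. 2 powr (- \<eta> * real j))"
  proof -
    have "2 powr (- \<eta>) < (1::real)" using \<eta> by (simp add: powr_less_one)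
    then have "summable (\<lambda>j::nat. (2 powr (- \<eta>)) ^ j)" by (intro summable_geometric) auto
    then show ?thesis by (simp add: powr_powr flip: powr_realpow)
  qed
  have S: "S < \<infinity>"
    unfolding S_def using sm by (subst suminf_ennreal2) auto
  have bd: "(\<integral>\<^sup>+z. G z * ennreal (damped_kernel \<eta> l z) \<partial>lborel) \<le> S * (2 * (ennreal (4 ^ DIM('a)) * B))" if l: "0 \<le> l" for l
  proof (cases "l = 0")
    case True
    then show ?thesis by (simp add: damped_kernel_def damped_def)
  next
    case False
    then have l: "0 < l" using l by simp
    have "(\<integral>\<^sup>+z. G z * ennreal (damped_kernel \<eta> l z) \<partial>lborel) \<le>
       (\<integral>\<^sup>+z. (\<Sum>j::nat. ennreal (2 powr (- \<eta> * real j)) * (W (l * 2 ^ j) z + W (l / 2 ^ j) z)) \<partial>lborel)"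
    proof (rule nn_integral_mono_AE)
      have "AE x in lborel. x \<noteq> (0::'a)" by (simp add: AE_lborel_singleton)
      then show "AE z in lborel. G z * ennreal (damped_kernel \<eta> l z) \<le> 
        (\<Sum>j::nat. ennreal (2 powr (- \<eta> * real j)) * (W (l * 2 ^ j) z + W (l / 2 ^ j) z))"
      proof eventually_elim
        case (elim z)
        obtain j :: nat where j: "damped_kernel \<eta> l z \<le> 2 powr (- \<eta> * real j) *
           ((2 * (l * 2 ^ j)) ^ DIM('a) * indicator (ball 0 (2 / (l * 2 ^ j))) z +
            (2 * (l / 2 ^ j)) ^ DIM('a) * indicator (ball 0 (2 / (l / 2 ^ j))) z)"
          using damped_kernel_dyadic_bound[OF l \<eta> elim] by blast
        have "G z * ennreal (damped_kernel \<eta> l z) \<le> G z * ennreal (2 powr (- \<eta> * real j) *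
           ((2 * (l * 2 ^ j)) ^ DIM('a) * indicator (ball 0 (2 / (l * 2 ^ j))) z +
            (2 * (l / 2 ^ j)) ^ DIM('a) * indicator (ball 0 (2 / (l / 2 ^ j))) z))"
          using j by (intro mult_left_mono ennreal_leI) auto
        also have "\<dots> = ennreal (2 powr (- \<eta> * real j)) * (W (l * 2 ^ j) z + W (l / 2 ^ j) z)"
        proof -
          have *: "ennreal (p * (a + b)) = ennreal p * (ennreal a + ennreal b)" if "0 \<le> p" "0 \<le> a" "0 \<le> b" for p a b :: real
            using that by (simp add: ennreal_mult)
          then show ?thesis
            unfolding W_def using l by (subst *) (auto simp: algebra_simps)
        qed
        \<comment> \<open>The one relevant term is bounded by the whole series, so the index j need
          not be chosen measurably in z.\<close>
        also have "\<dots> = (\<Sum>j\<in>{j}. ennreal (2 powr (- \<eta> * real j)) * (W (l * 2 ^ j) z + W (l / 2 ^ j) z))" by simp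
        also have "\<dots> \<le> (\<Sum>j::nat. ennreal (2 powr (- \<eta> * real j)) * (W (l * 2 ^ j) z + W (l / 2 ^ j) z))"
          by (rule sum_le_suminf) auto
        finally show ?case .
      qed
    qed
    also have "\<dots> = (\<Sum>j::nat. ennreal (2 powr (- \<eta> * real j)) * ((\<integral>\<^sup>+z. W (l * 2 ^ j) z \<partial>lborel) + (\<integral>\<^sup>+z. W (l / 2 ^ j) z \<partial>lborel)))"
      by (subst nn_integral_suminf) (auto simp: nn_integral_cmult nn_integral_add)
    also have "\<dots> = (\<Sum>j::nat. ennreal (2 powr (- \<eta> * real j)) * (2 * (ennreal (4 ^ DIM('a)) * B)))"
      using l by (subst (1 2) W) (auto simp: mult_2)
    also have "\<dots> = S * (2 * (ennreal (4 ^ DIM('a)) * B))"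
      by (simp add: S_def)
    finally show ?thesis .
  qed
  have "S * (2 * (ennreal (4 ^ DIM('a)) * B)) < \<infinity>"
    using S fin by (auto simp: ennreal_mult_less_top B_def)
  then obtain K where "0 \<le> K" "S * (2 * (ennreal (4 ^ DIM('a)) * B)) = ennreal K"
    using less_top_ennreal by auto
  then show ?thesis using bd by auto
qed

text \<open>Beyond distance 1/2 the log-condition gives no information, but there the kernel is at
  most 2^n and r \<ge> m suffices: f \<le> 1 + f^(r/m), and Young's inequality bounds \<omega>
  f^(r/m) by f^r + \<omega>^s. Since the distances stay below D, \<omega>^s is controlled by
  \<omega>^s times the damped kernel of scale 1, whose integral is finite in the
  application.\<close>

lemma kernel_pointwise_far:
  fixes n \<alpha> m s \<eta> \<omega> z r f D :: real
  assumes n: "0 < n" and m: "1 < m" "1 < s" "1 / m + 1 / s = 1"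
    and \<eta>: "0 < \<eta>" and \<alpha>: "0 \<le> \<alpha>" "\<alpha> \<le> n"
    and \<omega>: "1 \<le> \<omega>" and z: "1 / 2 < z" "z \<le> D" "2 \<le> D" and r: "m \<le> r" and f: "0 \<le> f"
  shows "\<omega> * z powr (\<alpha> - n) * f \<le> 2 powr n * (2 * D powr (n + \<eta>)) * (f powr r + \<omega> powr s * z powr (- n) * damped \<eta> z)"
proof -
  have \<omega>s: "\<omega> \<le> \<omega> powr s" using \<omega> m powr_mono[of 1 s \<omega>] by simp
  have "z powr (\<alpha> - n) \<le> (1 / 2) powr (\<alpha> - n)"
    using z \<alpha> by (intro powr_mono2') auto
  also have "\<dots> = 2 powr (n - \<alpha>)" using powr_minus_divide[of 2 "\<alpha> - n"] by (simp add: powr_divide)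
  also have "\<dots> \<le> 2 powr n" using \<alpha> by (intro powr_mono) auto
  finally have z1: "z powr (\<alpha> - n) \<le> 2 powr n" .
  have "f \<le> 1 + f powr (r / m)"
  proof (cases "f \<le> 1")
    case False
    then have "f powr 1 \<le> f powr (r / m)" using r m by (intro powr_mono) auto
    then show ?thesis using False by simp
  qed (smt (verit) powr_ge_zero)
  then have "\<omega> * f \<le> \<omega> * (1 + f powr (r / m))" using \<omega> by (intro mult_left_mono) auto
  also have "\<dots> = \<omega> + f powr (r / m) * \<omega>" by (simp add: algebra_simps)
  also have "f powr (r / m) * \<omega> \<le> (f powr (r / m)) powr m + \<omega> powr s"
    using m \<omega> by (intro Young_conjugate) auto
  also have "(f powr (r / m)) powr m = f powr r" using m by (simp add: powr_powr)
  finally have "\<omega> * f \<le> f powr r + 2 * \<omega> powr s" using \<omega>s by linarith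
  \<comment> \<open>As D \<ge> 2, z lies between 1/D and D; there the damping is at least
    D^(-\<eta>) and z^(-n) at least D^(-n).\<close>
  moreover have one: "1 \<le> D powr (n + \<eta>) * (z powr (- n) * damped \<eta> z)"
  proof -
    have "1 / D \<le> 1 / 2" "1 / D \<le> 1 / z" using z by (auto intro!: divide_left_mono)
    then have "1 / D \<le> z" "1 / D \<le> 1 / z" using z by linarith+
    then have "1 / D \<le> min z (1 / z)" by (rule min.boundedI)
    then have "(1 / D) powr \<eta> \<le> damped \<eta> z"
      unfolding damped_def using z \<eta> by (intro powr_mono2) auto
    moreover have "D powr (- n) \<le> z powr (- n)" using z n by (intro powr_mono2') auto
    ultimately have "D powr (n + \<eta>) * (D powr (- n) * (1 / D) powr \<eta>) \<le> D powr (n + \<eta>) * (z powr (- n) * damped \<eta> z)"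
      by (intro mult_left_mono mult_mono) auto
    moreover have "D powr (n + \<eta>) * (D powr (- n) * (1 / D) powr \<eta>) = 1"
      using z by (simp add: powr_divide powr_add powr_minus field_simps)
    ultimately show ?thesis by simp
  qed
  moreover have "1 \<le> D powr (n + \<eta>)" using z n \<eta> by (intro ge_one_powr_ge_zero) auto
  then have "f powr r * 1 \<le> f powr r * (2 * D powr (n + \<eta>))" by (intro mult_left_mono) auto
  moreover have "2 * \<omega> powr s * 1 \<le> 2 * \<omega> powr s * (D powr (n + \<eta>) * (z powr (- n) * damped \<eta> z))"
    using one by (intro mult_left_mono) auto
  ultimately have h: "\<omega> * f \<le> 2 * D powr (n + \<eta>) * (f powr r + \<omega> powr s * z powr (- n) * damped \<eta> z)"
    by (simp add: algebra_simps)
  have "z powr (\<alpha> - n) * (\<omega> * f) \<le> 2 powr n * (2 * D powr (n + \<eta>) * (f powr r + \<omega> powr s * z powr (- n) * damped \<eta> z))"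
    by (rule mult_mono[OF z1 h]) (use \<omega> f in auto)
  then show ?thesis by (simp add: mult_ac)
qed

section \<open>The potential estimate\<close>

definition damped_potential :: "real \<Rightarrow> ('a::euclidean_space \<Rightarrow> ennreal) \<Rightarrow> ('a \<Rightarrow> real) \<Rightarrow> 'a \<Rightarrow> ennreal" where
  "damped_potential \<eta> G \<Phi> x =
     (\<integral>\<^sup>+y. G (x - y) * ennreal (\<Phi> y * damped_kernel \<eta> (\<Phi> y powr (1 / DIM('a))) (x - y)) \<partial>lborel)"

lemma measurable_damped_potential [measurable]:
  fixes G :: "'a::euclidean_space \<Rightarrow> ennreal"
  assumes [measurable]: "G \<in> borel_measurable borel" "\<Phi> \<in> borel_measurable borel"
  shows "damped_potential \<eta> G \<Phi> \<in> borel_measurable borel"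
  unfolding damped_potential_def by measurable

text \<open>After Tonelli the inner integral is over x. The scale \<Phi>(y)^(1/n) depends on y
  alone, so the inner integral is one of those bounded by K after a translation.\<close>

lemma nn_integral_damped_potential_le:
  fixes G :: "'a::euclidean_space \<Rightarrow> ennreal"
  assumes [measurable]: "G \<in> borel_measurable borel" "\<Phi> \<in> borel_measurable borel"
    and \<Phi>: "\<And>y. 0 \<le> \<Phi> y"
    and K: "\<And>l. 0 \<le> l \<Longrightarrow> (\<integral>\<^sup>+z. G z * ennreal (damped_kernel \<eta> l z) \<partial>lborel) \<le> ennreal K"
  shows "(\<integral>\<^sup>+x. damped_potential \<eta> G \<Phi> x \<partial>lborel) \<le> ennreal K * (\<integral>\<^sup>+y. ennreal (\<Phi> y) \<partial>lborel)"
proof -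
  have "(\<integral>\<^sup>+x. damped_potential \<eta> G \<Phi> x \<partial>lborel) =
    (\<integral>\<^sup>+y. (\<integral>\<^sup>+x. G (x - y) * ennreal (\<Phi> y * damped_kernel \<eta> (\<Phi> y powr (1 / DIM('a))) (x - y)) \<partial>lborel) \<partial>lborel)"
    unfolding damped_potential_def by (rule lborel_pair.Fubini'[symmetric]) measurable
  also have "\<dots> = (\<integral>\<^sup>+y. (\<integral>\<^sup>+x. G x * ennreal (\<Phi> y * damped_kernel \<eta> (\<Phi> y powr (1 / DIM('a))) x) \<partial>lborel) \<partial>lborel)"
    by (intro nn_integral_cong nn_integral_lborel_translate) measurable
  also have "\<dots> = (\<integral>\<^sup>+y. ennreal (\<Phi> y) * (\<integral>\<^sup>+x. G x * ennreal (damped_kernel \<eta> (\<Phi> y powr (1 / DIM('a))) x) \<partial>lborel) \<partial>lborel)"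
    using \<Phi> by (intro nn_integral_cong, subst nn_integral_cmult[symmetric]) (auto simp: ennreal_mult mult_ac)
  also have "\<dots> \<le> (\<integral>\<^sup>+y. ennreal (\<Phi> y) * ennreal K \<partial>lborel)"
    by (intro nn_integral_mono mult_left_mono K) auto
  also have "\<dots> = ennreal K * (\<integral>\<^sup>+y. ennreal (\<Phi> y) \<partial>lborel)"
    by (subst nn_integral_multc) (auto simp: mult.commute)
  finally show ?thesis .
qed

text \<open>This integrates the near and far pointwise bounds in y. R is any number \<ge> 1 above
  the potential at x, and the alternative \<open>f y = 0\<close> takes care of the points outside
  U.\<close>

lemma kernel_potential_bound:
  fixes \<omega> \<Phi> f r :: "'a::euclidean_space \<Rightarrow> real" and x :: 'a and m s \<eta> \<alpha> p q A D K R :: real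
  assumes m: "1 < m" "1 < s" "1 / m + 1 / s = 1"
    and \<eta>: "0 < \<eta>" "\<eta> \<le> \<alpha>" "\<eta> \<le> DIM('a) / s" "\<eta> \<le> DIM('a) / p"
    and \<alpha>: "\<alpha> \<le> DIM('a)" and q: "1 \<le> q" "1 / p = 1 / q - \<alpha> / DIM('a)"
    and [measurable]: "\<omega> \<in> borel_measurable borel" and \<omega>: "\<And>z. 1 \<le> \<omega> z"
    and [measurable]: "\<Phi> \<in> borel_measurable borel" and \<Phi>: "\<And>y. 0 \<le> \<Phi> y" "(\<integral>\<^sup>+y. ennreal (\<Phi> y) \<partial>lborel) \<le> 1"
    and K: "0 \<le> K" "\<And>l. 0 \<le> l \<Longrightarrow> (\<integral>\<^sup>+z. ennreal (\<omega> z powr s) * ennreal (damped_kernel \<eta> l z) \<partial>lborel) \<le> ennreal K"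
    and R: "damped_potential \<eta> (\<lambda>z. ennreal (\<omega> z powr s)) \<Phi> x \<le> ennreal R" "1 \<le> R"
    and A: "0 \<le> A" and D: "2 \<le> D"
    and f: "AE y in lborel. f y = 0 \<or> (0 \<le> f y \<and> norm (x - y) \<le> D \<and> m \<le> r y \<and> \<Phi> y = f y powr r y \<and>
      (norm (x - y) \<le> 1 / 2 \<longrightarrow> \<bar>q - r y\<bar> \<le> A / (- ln (norm (x - y)))))"
  shows "(\<integral>\<^sup>+y. ennreal (\<omega> (x - y) * norm (x - y) powr (\<alpha> - DIM('a)) * f y) \<partial>lborel)
    \<le> ennreal ((1 + exp (DIM('a) * A / m) + 2 powr DIM('a) * (2 * D powr (DIM('a) + \<eta>))) * (2 + 2 * K) * R powr (1 / p))"
proof -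
  define n where "n = real DIM('a)"
  define C1 where "C1 = 1 + exp (n * A / m)"
  define C2 where "C2 = 2 powr n * (2 * D powr (n + \<eta>))"
  define W where "W y = \<omega> (x - y) powr s" for y
  define X where "X y = W y * (\<Phi> y * damped_kernel \<eta> (\<Phi> y powr (1 / n)) (x - y))" for y
  define k where "k l y = W y * damped_kernel \<eta> l (x - y)" for l y
  \<comment> \<open>The near bound supplies the first three summands, the far bound needs the second
    and fourth. Their integrals are at most 1, 1, K and K, whence the factor
    \<open>2 + 2 * K\<close>.\<close>
  define S where "S y = X y / R + \<Phi> y + k (R powr (1 / n)) y + k 1 y" for y
  have n: "0 < n" by (simp add: n_def)
  have C: "1 \<le> C1" "0 \<le> C2" using D by (auto simp: C1_def C2_def)
  have W0: "0 \<le> W y" for y by (simp add: W_def)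
  have pos: "0 \<le> X y" "0 \<le> k l y" for y l using \<Phi> W0 by (auto simp: X_def k_def)
  \<comment> \<open>The far bound carries no power of R and is absorbed by this inequality;
    positivity of p comes from 0 < \<eta> \<le> n/p.\<close>
  have Rp: "1 \<le> R powr (1 / p)"
  proof (rule ge_one_powr_ge_zero)
    have "0 < n / p" using \<eta> by (simp add: n_def)
    then show "0 \<le> 1 / p" using n by (simp add: zero_less_divide_iff)
  qed fact
  have kint: "(\<integral>\<^sup>+y. ennreal (k l y) \<partial>lborel) \<le> ennreal K" if "0 \<le> l" for l
  proof -
    have "(\<integral>\<^sup>+y. ennreal (k l y) \<partial>lborel) = (\<integral>\<^sup>+z. ennreal (\<omega> z powr s) * ennreal (damped_kernel \<eta> l z) \<partial>lborel)"
      unfolding k_def W_def by (subst nn_integral_lborel_reflect[symmetric, of _ x]) (auto simp: ennreal_mult)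
    then show ?thesis using K that by simp
  qed
  have [measurable]: "X \<in> borel_measurable borel" "\<And>l. k l \<in> borel_measurable borel"
    unfolding X_def k_def W_def by measurable
  have Xint: "(\<integral>\<^sup>+y. ennreal (X y / R) \<partial>lborel) \<le> 1"
  proof -
    have "(\<integral>\<^sup>+y. ennreal (X y / R) \<partial>lborel) = (\<integral>\<^sup>+y. ennreal (1 / R) * ennreal (X y) \<partial>lborel)"
      using R pos by (intro nn_integral_cong) (simp flip: ennreal_mult)
    also have "\<dots> = ennreal (1 / R) * (\<integral>\<^sup>+y. ennreal (X y) \<partial>lborel)" by (simp add: nn_integral_cmult)
    also have "(\<integral>\<^sup>+y. ennreal (X y) \<partial>lborel) = damped_potential \<eta> (\<lambda>z. ennreal (\<omega> z powr s)) \<Phi> x"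
      unfolding damped_potential_def X_def W_def n_def using \<Phi> by (intro nn_integral_cong) (auto simp: ennreal_mult)
    also have "ennreal (1 / R) * \<dots> \<le> ennreal (1 / R) * ennreal R" by (intro mult_left_mono R) auto
    also have "\<dots> = 1" using R by (simp flip: ennreal_mult)
    finally show ?thesis .
  qed
  have "(\<integral>\<^sup>+y. ennreal (\<omega> (x - y) * norm (x - y) powr (\<alpha> - n) * f y) \<partial>lborel)
    \<le> (\<integral>\<^sup>+y. ennreal ((C1 + C2) * R powr (1 / p)) * ennreal (S y) \<partial>lborel)"
  proof (rule nn_integral_mono_AE)
    have "AE y in lborel. y \<noteq> x" by (simp add: AE_lborel_singleton)
    with f show "AE y in lborel. ennreal (\<omega> (x - y) * norm (x - y) powr (\<alpha> - n) * f y)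
       \<le> ennreal ((C1 + C2) * R powr (1 / p)) * ennreal (S y)"
    proof eventually_elim
      case (elim y)
      define z where "z = norm (x - y)"
      have z: "0 < z" using elim by (simp add: z_def)
      have S0: "0 \<le> S y" using pos \<Phi> R by (simp add: S_def)
      have "\<omega> (x - y) * z powr (\<alpha> - n) * f y \<le> (C1 + C2) * R powr (1 / p) * S y"
      proof (cases "f y = 0")
        case True
        then show ?thesis using S0 C by simp
      next
        case False
        with elim have E: "0 \<le> f y" "z \<le> D" "m \<le> r y" "\<Phi> y = f y powr r y"
          "z \<le> 1 / 2 \<longrightarrow> \<bar>q - r y\<bar> \<le> A / (- ln z)" by (auto simp: z_def)
        show ?thesis
        proof (cases "z \<le> 1 / 2")
          case True
          have "\<omega> (x - y) * z powr (\<alpha> - n) * f y \<le> C1 * (R powr (1 / p) *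
             (\<omega> (x - y) powr s * f y powr r y * z powr (- n) * damped \<eta> ((f y powr r y) powr (1 / n) * z) / R + f y powr r y
              + \<omega> (x - y) powr s * z powr (- n) * damped \<eta> (R powr (1 / n) * z)))"
            unfolding C1_def using E True z n m \<eta> q \<omega> R A
            by (intro kernel_pointwise_near) (auto simp: n_def)
          also have "\<dots> = C1 * R powr (1 / p) * (X y / R + \<Phi> y + k (R powr (1 / n)) y)"
            by (simp add: X_def k_def W_def damped_kernel_def E(4) z_def n_def mult_ac)
          also have "\<dots> \<le> (C1 + C2) * R powr (1 / p) * S y"
            unfolding S_def using C pos \<Phi> R by (intro mult_mono) auto
          finally show ?thesis .
        next
          case False
          have "\<omega> (x - y) * z powr (\<alpha> - n) * f y \<le> C2 * 
             (f y powr r y + \<omega> (x - y) powr s * z powr (- n) * damped \<eta> z)"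
            unfolding C2_def using E False z n m \<eta> \<alpha> q \<omega> R A D
            by (intro kernel_pointwise_far) (auto simp: n_def)
          also have "\<dots> = C2 * 1 * (\<Phi> y + k 1 y)"
            by (simp add: k_def W_def damped_kernel_def E(4) z_def n_def mult_ac)
          also have "\<dots> \<le> (C1 + C2) * R powr (1 / p) * S y"
            unfolding S_def using C pos \<Phi> R Rp by (intro mult_mono) auto
          finally show ?thesis .
        qed
      qed
      then have "ennreal (\<omega> (x - y) * z powr (\<alpha> - n) * f y) \<le> ennreal ((C1 + C2) * R powr (1 / p) * S y)"
        by (rule ennreal_leI)
      then show ?case using S0 C by (simp add: ennreal_mult z_def)
    qed
  qed
  also have "\<dots> = ennreal ((C1 + C2) * R powr (1 / p)) * (\<integral>\<^sup>+y. ennreal (S y) \<partial>lborel)"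
    unfolding S_def by (subst nn_integral_cmult) auto
  also have "(\<integral>\<^sup>+y. ennreal (S y) \<partial>lborel) = (\<integral>\<^sup>+y. ennreal (X y / R) + ennreal (\<Phi> y) + ennreal (k (R powr (1 / n)) y) + ennreal (k 1 y) \<partial>lborel)"
    unfolding S_def using pos \<Phi> R by (intro nn_integral_cong) simp
  also have "\<dots> = (\<integral>\<^sup>+y. ennreal (X y / R) \<partial>lborel) + (\<integral>\<^sup>+y. ennreal (\<Phi> y) \<partial>lborel)
     + (\<integral>\<^sup>+y. ennreal (k (R powr (1 / n)) y) \<partial>lborel) + (\<integral>\<^sup>+y. ennreal (k 1 y) \<partial>lborel)"
    by (simp add: nn_integral_add)
  also have "\<dots> \<le> 1 + 1 + ennreal K + ennreal K"
    by (intro add_mono Xint \<Phi> kint) auto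
  also have "\<dots> = ennreal (2 + 2 * K)" 
  proof -
    have "1 + 1 + ennreal K + ennreal K = ennreal (1 + 1 + K + K)"
      using K by (simp only: ennreal_plus ennreal_1 zero_le_one add_nonneg_nonneg)
    then show ?thesis by (simp add: algebra_simps)
  qed
  also have "ennreal ((C1 + C2) * R powr (1 / p)) * ennreal (2 + 2 * K) = ennreal ((C1 + C2) * (2 + 2 * K) * R powr (1 / p))"
    using C K by (subst ennreal_mult[symmetric]) (auto simp: mult_ac)
  finally show ?thesis
    by (simp add: C1_def C2_def n_def mult_left_mono)
qed

section \<open>Minkowski's inequality for finite families\<close>

text \<open>Hoelder's inequality with exponents r and u = r / (r - 1): Young's inequality is applied
  termwise after normalising the two factors by B^(1/r) and C^(1 - 1/r), and the weights 1/r and 1/u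
  add up to 1.\<close>

lemma Holder_power_sum:
  fixes c b :: "'i \<Rightarrow> real"
  assumes "finite I" "1 < r" "\<And>i. i \<in> I \<Longrightarrow> 0 \<le> c i" "\<And>i. i \<in> I \<Longrightarrow> 0 \<le> b i"
    and C: "0 < (\<Sum>i\<in>I. c i powr r)"
  shows "(\<Sum>i\<in>I. c i powr (r - 1) * b i) \<le> (\<Sum>i\<in>I. c i powr r) powr (1 - 1 / r) * (\<Sum>i\<in>I. b i powr r) powr (1 / r)"
proof -
  define C B where "C = (\<Sum>i\<in>I. c i powr r)" and "B = (\<Sum>i\<in>I. b i powr r)"
  have B0: "0 \<le> B" by (simp add: B_def sum_nonneg)
  show ?thesis
  proof (cases "B = 0")
    case True
    then have "\<forall>i\<in>I. b i powr r = 0" using assms(1) by (simp add: B_def sum_nonneg_eq_0_iff)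
    then show ?thesis by (simp add: sum_nonneg)
  next
    case False
    then have B: "0 < B" using B0 by simp
    have C: "0 < C" using C by (simp add: C_def)
    define P where "P = C powr (1 - 1 / r) * B powr (1 / r)"
    have P: "0 < P" using B C by (simp add: P_def)
    define u where "u = r / (r - 1)"
    have u: "0 \<le> 1 / r" "0 \<le> 1 / u" "1 / r + 1 / u = 1" "1 < u" using assms(2) by (auto simp: u_def field_simps)
    have "c i powr (r - 1) * b i \<le> P * (b i powr r / B / r + c i powr r / C / u)" if i: "i \<in> I" for i
    proof -
      have "(b i / B powr (1 / r)) * (c i powr (r - 1) / C powr (1 - 1 / r)) \<le>
         (b i / B powr (1 / r)) powr r / r + (c i powr (r - 1) / C powr (1 - 1 / r)) powr u / u"
        by (rule Youngs_inequality) (use assms i u in auto)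
      also have "(b i / B powr (1 / r)) powr r = b i powr r / B"
        using assms(2) B by (simp add: powr_divide powr_powr)
      also have "(c i powr (r - 1) / C powr (1 - 1 / r)) powr u = c i powr r / C"
      proof -
        have "(r - 1) * u = r" "(1 - 1 / r) * u = 1" using assms(2) by (auto simp: u_def field_simps)
        then show ?thesis using C by (simp add: powr_divide powr_powr)
      qed
      finally have "P * ((b i / B powr (1 / r)) * (c i powr (r - 1) / C powr (1 - 1 / r))) \<le> P * (b i powr r / B / r + c i powr r / C / u)"
        using P by (intro mult_left_mono) auto
      moreover have "P * ((b i / B powr (1 / r)) * (c i powr (r - 1) / C powr (1 - 1 / r))) = c i powr (r - 1) * b i"
        using B C by (simp add: P_def)
      ultimately show ?thesis by simp
    qed
    then have "(\<Sum>i\<in>I. c i powr (r - 1) * b i) \<le> (\<Sum>i\<in>I. P * (b i powr r / B / r + c i powr r / C / u))"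
      by (rule sum_mono)
    also have "\<dots> = P * (B / B / r + C / C / u)"
      by (simp add: C_def B_def sum.distrib flip: sum_distrib_left sum_divide_distrib)
    also have "\<dots> = P" using B C u by simp
    finally show ?thesis by (simp add: P_def C_def B_def)
  qed
qed

lemma lr_sum_nonneg [simp]: "0 \<le> lr_sum r N g x"
  by (simp add: lr_sum_def)

lemma lr_sum_eq_abs:
  assumes "0 < r"
  shows "lr_sum r N (\<lambda>k y. a y * g k y) x = \<bar>a x\<bar> * lr_sum r N g x"
  using assms by (simp add: lr_sum_def abs_mult powr_mult powr_powr sum_nonneg flip: sum_distrib_left)

lemma abs_le_lr_sum:
  assumes "0 < r" "k \<in> {1..N}"
  shows "\<bar>g k x\<bar> \<le> lr_sum r N g x"
proof -
  have "\<bar>g k x\<bar> = (\<bar>g k x\<bar> powr r) powr (1 / r)" using assms by (simp add: powr_powr)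
  also have "\<dots> \<le> (\<Sum>k=1..N. \<bar>g k x\<bar> powr r) powr (1 / r)"
    using assms by (intro powr_mono2 member_le_sum) auto
  finally show ?thesis by (simp add: lr_sum_def)
qed

text \<open>Minkowski's integral inequality by duality. With c_k the modulus of the integral of g_k
  and S the sum of c_k^r, writing c_k^r = c_k^(r-1) c_k and applying Hoelder under the integral
  gives S \<le> S^(1 - 1/r) J; for S > 0 this yields S^(1/r) \<le> J. The point x on the left is a
  dummy, as that family consists of constants.\<close>

lemma lr_sum_integral_le:
  assumes r: "1 < r" and int: "\<And>k. k \<in> {1..N} \<Longrightarrow> integrable M (g k)"
    and intL: "integrable M (lr_sum r N g)"
  shows "lr_sum r N (\<lambda>k _. LINT y|M. g k y) x \<le> (LINT y|M. lr_sum r N g y)"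
proof -
  define c where "c k = \<bar>LINT y|M. g k y\<bar>" for k
  define S where "S = (\<Sum>k=1..N. c k powr r)"
  define J where "J = (LINT y|M. lr_sum r N g y)"
  have J: "0 \<le> J" by (simp add: J_def)
  have S0: "0 \<le> S" by (simp add: S_def sum_nonneg)
  show ?thesis
  proof (cases "S = 0")
    case True
    then show ?thesis using J by (simp add: lr_sum_def S_def J_def c_def)
  next
    case False
    then have S: "0 < S" using S0 by simp
    have "S = (\<Sum>k=1..N. c k powr (r - 1) * c k)"
      unfolding S_def using r by (intro sum.cong) (auto simp: c_def powr_mult_base' mult.commute powr_mult_base)
    also have "\<dots> \<le> (\<Sum>k=1..N. c k powr (r - 1) * (LINT y|M. \<bar>g k y\<bar>))"
      by (intro sum_mono mult_left_mono) (auto simp: c_def)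
    also have "\<dots> = (LINT y|M. (\<Sum>k=1..N. c k powr (r - 1) * \<bar>g k y\<bar>))"
      using int by (subst Bochner_Integration.integral_sum) auto
    also have "\<dots> \<le> (LINT y|M. S powr (1 - 1 / r) * lr_sum r N g y)"
    proof (rule integral_mono)
      fix y
      show "(\<Sum>k=1..N. c k powr (r - 1) * \<bar>g k y\<bar>) \<le> S powr (1 - 1 / r) * lr_sum r N g y"
        unfolding S_def lr_sum_def using r S by (intro Holder_power_sum) (auto simp: c_def S_def)
    qed (use int intL in auto)
    also have "\<dots> = S powr (1 - 1 / r) * J" by (simp add: J_def)
    finally have "S powr (1 / r) * S \<le> S powr (1 / r) * (S powr (1 - 1 / r) * J)" by (intro mult_left_mono) auto
    also have "\<dots> = S * J" using S by (simp add: mult.assoc[symmetric] flip: powr_add)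
    finally have "S powr (1 / r) \<le> J" using S by (simp add: mult.commute)
    then show ?thesis by (simp add: lr_sum_def S_def c_def J_def)
  qed
qed

section \<open>Borel versions and measurability\<close>

text \<open>The two preimages of a set differ only inside a null set, all of whose subsets are
  Lebesgue measurable by completeness.\<close>

lemma borel_measurable_lebesgue_AE_cong:
  fixes f g :: "'a::euclidean_space \<Rightarrow> 'b::topological_space"
  assumes f: "f \<in> borel_measurable lebesgue" and eq: "AE x in lebesgue. f x = g x"
  shows "g \<in> borel_measurable lebesgue"
proof (rule measurableI)
  fix A :: "'b set" assume A: "A \<in> sets borel"
  obtain N where N: "\<And>x. x \<in> space lebesgue - N \<Longrightarrow> f x = g x" "N \<in> null_sets lebesgue"
    using AE_E3[OF eq] by blast
  have "g -` A \<inter> N \<in> null_sets lebesgue"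
    by (rule null_sets_completion_subset[OF _ N(2)]) auto
  then have "g -` A \<inter> N \<in> sets lebesgue" by auto
  moreover have "f -` A \<inter> space lebesgue \<in> sets lebesgue" using f A by (rule measurable_sets)
  ultimately have "(f -` A \<inter> space lebesgue - N) \<union> (g -` A \<inter> N) \<in> sets lebesgue" using N(2) by auto
  also have "(f -` A \<inter> space lebesgue - N) \<union> (g -` A \<inter> N) = g -` A \<inter> space lebesgue"
    using N(1) by auto
  finally show "g -` A \<inter> space lebesgue \<in> sets lebesgue" .
qed auto

text \<open>\<Omega> is measurable only for the completed surface measure, whereas the Tonelli
  arguments and compositions with x - y call for Borel functions. A Borel version on the sphere is
  extended by homogeneity.\<close>

lemma homogeneous_Ls_borel_version:
  fixes \<Omega> :: "'a::euclidean_space \<Rightarrow> real"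
  assumes "\<Omega> \<in> homogeneous_Ls s"
  obtains \<Omega>' where "\<Omega>' \<in> borel_measurable borel" "\<And>t x. 0 < t \<Longrightarrow> x \<noteq> 0 \<Longrightarrow> \<Omega>' (t *\<^sub>R x) = \<Omega>' x"
    "AE z in lborel. \<Omega> z = \<Omega>' z" "(\<integral>\<^sup>+z. ennreal (\<bar>\<Omega>' z\<bar> powr s) * indicator (ball 0 1) z \<partial>lborel) < \<infinity>"
proof -
  define \<nu> where "\<nu> = distr (restrict_space lborel (ball 0 1 - {0})) (restrict_space borel (sphere 0 1)) (sgn :: 'a \<Rightarrow> 'a)"
  define \<mu> where "\<mu> = scale_measure (of_nat DIM('a)) \<nu>"
  have sp: "sphere_measure = completion \<mu>" by (simp add: sphere_measure_def \<mu>_def \<nu>_def)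
  have hom: "\<And>t x. 0 < t \<Longrightarrow> x \<noteq> 0 \<Longrightarrow> \<Omega> (t *\<^sub>R x) = \<Omega> x"
    and meas: "\<Omega> \<in> borel_measurable (completion \<mu>)"
    and fin: "(\<integral>\<^sup>+x. ennreal (\<bar>\<Omega> x\<bar> powr s) \<partial>completion \<mu>) < \<infinity>"
    using assms by (auto simp: homogeneous_Ls_def sp)
  obtain \<Omega>1 where \<Omega>1: "\<Omega>1 \<in> borel_measurable \<mu>" "AE x in \<mu>. \<Omega> x = \<Omega>1 x"
    using completion_ex_borel_measurable_real[OF meas] by blast
  have sets_\<nu>: "sets \<nu> = sets (restrict_space borel (sphere 0 1))" by (simp add: \<nu>_def)
  have \<Omega>1m: "\<Omega>1 \<in> borel_measurable (restrict_space borel (sphere 0 1))"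
    using \<Omega>1(1) by (simp add: \<mu>_def \<nu>_def cong: measurable_cong_sets)
  \<comment> \<open>The origin is treated apart because \<open>sgn 0 = 0\<close> is not on the
    sphere, the space on which \<open>\<Omega>1\<close> is measurable.\<close>
  define \<Omega>' where "\<Omega>' z = (if z = 0 then 0 else \<Omega>1 (sgn z))" for z
  have "sgn \<in> restrict_space borel (- {0}) \<rightarrow>\<^sub>M restrict_space borel (sphere (0::'a) 1)"
  proof (rule measurable_restrict_space2)
    show "sgn \<in> space (restrict_space borel (- {0})) \<rightarrow> sphere (0::'a) 1"
      by (auto simp: space_restrict_space norm_sgn)
    have "continuous_on (- {0}) (sgn :: 'a \<Rightarrow> 'a)"
      unfolding sgn_div_norm by (intro continuous_intros) auto
    then show "sgn \<in> restrict_space borel (- {0}) \<rightarrow>\<^sub>M (borel :: 'a measure)"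
      by (rule borel_measurable_continuous_on_restrict)
  qed
  from measurable_compose[OF this \<Omega>1m]
  have "(\<lambda>z. \<Omega>1 (sgn z)) \<in> borel_measurable (restrict_space borel {z. \<not> z = 0})"
    by (simp add: Compl_eq)
  then have m: "\<Omega>' \<in> borel_measurable borel"
    unfolding \<Omega>'_def[abs_def] by (subst measurable_If_restrict_space_iff) auto
  have h: "\<Omega>' (t *\<^sub>R x) = \<Omega>' x" if "0 < t" "x \<noteq> 0" for t x
    using that by (simp add: \<Omega>'_def sgn_scaleR)
  have "AE x in \<nu>. \<Omega> x = \<Omega>1 x"
  proof -
    obtain N where N: "\<And>x. x \<in> space \<mu> - N \<Longrightarrow> \<Omega> x = \<Omega>1 x" "N \<in> null_sets \<mu>"
      using AE_E3[OF \<Omega>1(2)] by blast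
    then have "N \<in> null_sets \<nu>" by (auto simp: null_sets_def \<mu>_def)
    then show ?thesis by (rule AE_I') (use N(1) in \<open>auto simp: \<mu>_def space_scale_measure\<close>)
  qed
  then have "AE z in restrict_space lborel (ball 0 1 - {0}). \<Omega> (sgn z) = \<Omega>1 (sgn z)"
    unfolding \<nu>_def by (rule AE_distrD[OF sgn_measurable_sphere])
  then have "AE z in lborel. z \<in> ball 0 1 - {0} \<longrightarrow> \<Omega> (sgn z) = \<Omega>1 (sgn z)"
    by (subst (asm) AE_restrict_space_iff) auto
  \<comment> \<open>The definition of surface measure gives equality only inside the unit ball.
    Countably many dilations spread it: every nonzero z lands in the punctured ball after division
    by some k + 1, and countably many null sets have null union.\<close>
  then have "AE z in lborel. (0 + (1 / real (Suc k)) *\<^sub>R z) \<in> ball 0 1 - {0} \<longrightarrow>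
      \<Omega> (sgn (0 + (1 / real (Suc k)) *\<^sub>R z)) = \<Omega>1 (sgn (0 + (1 / real (Suc k)) *\<^sub>R z))" for k :: nat
    by (rule AE_lborel_affine) auto
  then have "AE z in lborel. \<forall>k::nat. (0 + (1 / real (Suc k)) *\<^sub>R z) \<in> ball 0 1 - {0} \<longrightarrow>
      \<Omega> (sgn (0 + (1 / real (Suc k)) *\<^sub>R z)) = \<Omega>1 (sgn (0 + (1 / real (Suc k)) *\<^sub>R z))"
    by (simp only: AE_all_countable) blast
  moreover have "AE z in lborel. z \<noteq> (0::'a)" by (simp add: AE_lborel_singleton)
  ultimately have ae: "AE z in lborel. \<Omega> z = \<Omega>' z"
  proof eventually_elim
    case (elim z)
    obtain k :: nat where k: "norm z < real k" using reals_Archimedean2 by blast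
    have "(0 + (1 / real (Suc k)) *\<^sub>R z) \<in> ball 0 1 - {0}" using k elim by (simp add: field_simps)
    then have "\<Omega> (sgn z) = \<Omega>1 (sgn z)" using elim(1)[rule_format, of k] by (simp add: sgn_scaleR)
    moreover have "\<Omega> (sgn z) = \<Omega> z" using hom[of "inverse (norm z)" z] elim by (simp add: sgn_div_norm)
    ultimately show ?case using elim by (simp add: \<Omega>'_def)
  qed
  \<comment> \<open>By the construction of surface measure as a push-forward, the surface integral
    is n times the integral of |\<Omega>'|^s over the unit ball.\<close>
  have "(\<integral>\<^sup>+x. ennreal (\<bar>\<Omega> x\<bar> powr s) \<partial>completion \<mu>) = (\<integral>\<^sup>+x. ennreal (\<bar>\<Omega>1 x\<bar> powr s) \<partial>\<mu>)"
    unfolding nn_integral_completion using \<Omega>1(2) by (intro nn_integral_cong_AE) auto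
  also have "\<dots> = of_nat DIM('a) * (\<integral>\<^sup>+x. ennreal (\<bar>\<Omega>1 x\<bar> powr s) \<partial>\<nu>)"
    unfolding \<mu>_def by (rule nn_integral_scale_measure) (use \<Omega>1m in \<open>simp add: \<nu>_def\<close>)
  also have "(\<integral>\<^sup>+x. ennreal (\<bar>\<Omega>1 x\<bar> powr s) \<partial>\<nu>) =
      (\<integral>\<^sup>+z. ennreal (\<bar>\<Omega>1 (sgn z)\<bar> powr s) \<partial>restrict_space lborel (ball 0 1 - {0}))"
    unfolding \<nu>_def by (rule nn_integral_distr[OF sgn_measurable_sphere]) (use \<Omega>1m in simp)
  also have "\<dots> = (\<integral>\<^sup>+z. ennreal (\<bar>\<Omega>1 (sgn z)\<bar> powr s) * indicator (ball 0 1 - {0}) z \<partial>lborel)"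
    by (rule nn_integral_restrict_space) auto
  also have "\<dots> = (\<integral>\<^sup>+z. ennreal (\<bar>\<Omega>' z\<bar> powr s) * indicator (ball 0 1) z \<partial>lborel)"
  proof (rule nn_integral_cong_AE)
    have "AE z in lborel. z \<noteq> (0::'a)" by (simp add: AE_lborel_singleton)
    then show "AE z in lborel. ennreal (\<bar>\<Omega>1 (sgn z)\<bar> powr s) * indicator (ball 0 1 - {0}) z =
       ennreal (\<bar>\<Omega>' z\<bar> powr s) * indicator (ball 0 1) z"
      by eventually_elim (auto simp: \<Omega>'_def indicator_def)
  qed
  finally have "of_nat DIM('a) * (\<integral>\<^sup>+z. ennreal (\<bar>\<Omega>' z\<bar> powr s) * indicator (ball 0 1) z \<partial>lborel) < \<infinity>"
    using fin by simp
  then have "(\<integral>\<^sup>+z. ennreal (\<bar>\<Omega>' z\<bar> powr s) * indicator (ball 0 1) z \<partial>lborel) < \<infinity>"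
    by (auto simp: ennreal_mult_less_top)
  then show ?thesis using that m h ae by blast
qed

lemma AE_lebesgue_iff: "(AE x in lebesgue. P x) \<longleftrightarrow> (AE x in lborel. P x)"
  by (rule AE_completion_iff)

lemma AE_lebesgue_on_iff:
  assumes "U \<in> sets lebesgue"
  shows "(AE x in lebesgue_on U. P x) \<longleftrightarrow> (AE x in lborel. x \<in> U \<longrightarrow> P x)"
proof -
  have "U \<inter> space lebesgue \<in> sets lebesgue" using assms by simp
  from AE_restrict_space_iff[OF this, of P] show ?thesis
    unfolding AE_completion_iff .
qed

lemma borel_version_on:
  fixes f :: "'a::euclidean_space \<Rightarrow> real"
  assumes U: "U \<in> sets lebesgue" and f: "f \<in> borel_measurable (lebesgue_on U)"
  obtains g where "g \<in> borel_measurable borel" "AE x in lborel. g x = (if x \<in> U then f x else 0)"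
proof -
  have "(\<lambda>x. if x \<in> U then f x else 0) \<in> borel_measurable (completion lborel)"
    using f U by (simp add: borel_measurable_if)
  then obtain g where g: "g \<in> borel_measurable lborel" "AE x in lborel. (if x \<in> U then f x else 0) = g x"
    using completion_ex_borel_measurable_real by blast
  have "AE x in lborel. g x = (if x \<in> U then f x else 0)" using g(2) by eventually_elim simp
  with g(1) show ?thesis by (intro that[of g]) auto
qed

lemma AE_lborel_reflect:
  fixes P :: "'a::euclidean_space \<Rightarrow> bool"
  assumes "AE z in lborel. P z"
  shows "AE y in lborel. P (x - y)"
  using AE_lborel_affine[OF assms, of "-1" x] by simp

section \<open>Measurability of the rough fractional integral\<close>

lemma frac_integrand_AE_borel:
  fixes \<Omega> \<Omega>' f f' \<alpha> \<alpha>' :: "'a::euclidean_space \<Rightarrow> real"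
  assumes "AE z in lborel. \<Omega> z = \<Omega>' z" "AE y in lborel. f' y = (if y \<in> U then f y else 0)" "\<alpha>' x = \<alpha> x"
  shows "AE y in lborel. \<Omega>' (x - y) / norm (x - y) powr (real DIM('a) - \<alpha>' x) * f' y = frac_integrand U \<Omega> \<alpha> f x y"
  using AE_lborel_reflect[OF assms(1), of x] assms(2)
  by eventually_elim (auto simp: frac_integrand_def assms(3))

lemma frac_integrand_measurable:
  fixes \<Omega> \<Omega>' f \<alpha> :: "'a::euclidean_space \<Rightarrow> real"
  assumes U: "U \<in> sets lebesgue" and f: "f \<in> borel_measurable (lebesgue_on U)"
    and \<Omega>: "\<Omega>' \<in> borel_measurable borel" "AE z in lborel. \<Omega> z = \<Omega>' z"
  shows "frac_integrand U \<Omega> \<alpha> f x \<in> borel_measurable lebesgue"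
proof -
  obtain f' where f'[measurable]: "f' \<in> borel_measurable borel" "AE x in lborel. f' x = (if x \<in> U then f x else 0)"
    using borel_version_on[OF U f] by blast
  note [measurable] = \<Omega>(1)
  show ?thesis
  proof (rule borel_measurable_lebesgue_AE_cong)
    have "(\<lambda>y. \<Omega>' (x - y) / norm (x - y) powr (real DIM('a) - \<alpha> x) * f' y) \<in> borel_measurable borel"
      by measurable
    then show "(\<lambda>y. \<Omega>' (x - y) / norm (x - y) powr (real DIM('a) - \<alpha> x) * f' y) \<in> borel_measurable lebesgue"
      by (intro measurable_completion) simp
    show "AE y in lebesgue. \<Omega>' (x - y) / norm (x - y) powr (real DIM('a) - \<alpha> x) * f' y = frac_integrand U \<Omega> \<alpha> f x y"
      unfolding AE_lebesgue_iff using \<Omega>(2) f'(2) by (intro frac_integrand_AE_borel) auto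
  qed
qed

text \<open>Borel versions of \<Omega>, f and \<alpha> make the integrand jointly measurable in (x,
  y), so the parametric integral \<open>J\<close> is Borel. It agrees with the original at every x
  where the version of \<alpha> is exact, hence almost everywhere on U, and completeness finishes
  the proof.\<close>

lemma frac_integral_measurable:
  fixes \<Omega> \<Omega>' f \<alpha> :: "'a::euclidean_space \<Rightarrow> real"
  assumes U: "U \<in> sets lebesgue" and f: "f \<in> borel_measurable (lebesgue_on U)" and \<alpha>: "\<alpha> \<in> borel_measurable (lebesgue_on U)"
    and \<Omega>: "\<Omega>' \<in> borel_measurable borel" "AE z in lborel. \<Omega> z = \<Omega>' z"
  shows "frac_integral U \<Omega> \<alpha> f \<in> borel_measurable (lebesgue_on U)"
proof -
  obtain f' where f'[measurable]: "f' \<in> borel_measurable borel" "AE x in lborel. f' x = (if x \<in> U then f x else 0)"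
    using borel_version_on[OF U f] by blast
  obtain \<alpha>' where \<alpha>'[measurable]: "\<alpha>' \<in> borel_measurable borel" "AE x in lborel. \<alpha>' x = (if x \<in> U then \<alpha> x else 0)"
    using borel_version_on[OF U \<alpha>] by blast
  note [measurable] = \<Omega>(1)
  define k where "k x y = \<Omega>' (x - y) / norm (x - y) powr (real DIM('a) - \<alpha>' x) * f' y" for x y
  define J where "J x = (LINT y|lborel. k x y)" for x
  have kx: "k x \<in> borel_measurable borel" for x unfolding k_def by measurable
  have "J \<in> borel_measurable borel" unfolding J_def k_def by measurable
  then have "J \<in> borel_measurable lebesgue" by (intro measurable_completion) simp
  then have JU: "(\<lambda>x. if x \<in> U then J x else 0) \<in> borel_measurable lebesgue"
    using U by (intro measurable_If_set) auto
  have eq: "frac_integral U \<Omega> \<alpha> f x = J x" if "\<alpha>' x = \<alpha> x" for x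
  proof -
    have "(LINT y|lebesgue. frac_integrand U \<Omega> \<alpha> f x y) = (LINT y|lebesgue. k x y)"
    proof (rule integral_cong_AE)
      show "frac_integrand U \<Omega> \<alpha> f x \<in> borel_measurable lebesgue"
        by (rule frac_integrand_measurable[OF U f \<Omega>])
      show "k x \<in> borel_measurable lebesgue" using kx by (intro measurable_completion) simp
      have "AE y in lborel. k x y = frac_integrand U \<Omega> \<alpha> f x y"
        unfolding k_def using \<Omega>(2) f'(2) that by (rule frac_integrand_AE_borel)
      then show "AE y in lebesgue. frac_integrand U \<Omega> \<alpha> f x y = k x y"
        unfolding AE_lebesgue_iff by eventually_elim simp
    qed
    also have "\<dots> = J x" unfolding J_def using kx by (intro integral_completion) simp
    finally show ?thesis by (simp add: frac_integral_def)
  qed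
  have "(\<lambda>x. if x \<in> U then frac_integral U \<Omega> \<alpha> f x else 0) \<in> borel_measurable lebesgue"
  proof (rule borel_measurable_lebesgue_AE_cong[OF JU])
    show "AE x in lebesgue. (if x \<in> U then J x else 0) = (if x \<in> U then frac_integral U \<Omega> \<alpha> f x else 0)"
      unfolding AE_lebesgue_iff using \<alpha>'(2) by eventually_elim (auto simp: eq)
  qed
  then show ?thesis using U by (simp add: borel_measurable_if)
qed

section \<open>Modulars and norms\<close>

text \<open>Since q \<ge> 1, division by c \<ge> 1 gains at least the factor 1/c under the
  power.\<close>

lemma modular_mono_scale:
  fixes q :: "'a::euclidean_space \<Rightarrow> real"
  assumes f: "f \<in> borel_measurable (lebesgue_on U)" and q: "\<And>x. x \<in> U \<Longrightarrow> 1 \<le> q x"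
    and qm: "q \<in> borel_measurable (lebesgue_on U)" and c: "1 \<le> c" 
  shows "modular U q (\<lambda>x. f x / c) \<le> ennreal (1 / c) * modular U q f"
proof -
  note [measurable] = f qm
  have "modular U q (\<lambda>x. f x / c) \<le> (\<integral>\<^sup>+x. ennreal (1 / c) * ennreal (\<bar>f x\<bar> powr q x) \<partial>lebesgue_on U)"
    unfolding modular_def
  proof (rule nn_integral_mono)
    fix x assume "x \<in> space (lebesgue_on U)"
    then have x: "1 \<le> q x" using q by (simp add: space_restrict_space)
    have "c powr 1 \<le> c powr q x" using x c by (intro powr_mono) auto
    then have "1 / c powr q x \<le> 1 / c" using c by (intro divide_left_mono) auto
    then have "\<bar>f x\<bar> powr q x * (1 / c powr q x) \<le> \<bar>f x\<bar> powr q x * (1 / c)"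
      by (intro mult_left_mono) auto
    then have "\<bar>f x / c\<bar> powr q x \<le> 1 / c * \<bar>f x\<bar> powr q x"
      using c by (simp add: powr_divide)
    then show "ennreal (\<bar>f x / c\<bar> powr q x) \<le> ennreal (1 / c) * ennreal (\<bar>f x\<bar> powr q x)"
      using c by (simp flip: ennreal_mult add: ennreal_leI)
  qed
  also have "\<dots> = ennreal (1 / c) * modular U q f"
    unfolding modular_def by (rule nn_integral_cmult) measurable
  finally show ?thesis .
qed

text \<open>The set whose infimum is the norm is nonempty: a finite modular is brought down to 1 by
  dividing further by the maximum of 1 and its value.\<close>

lemma Lvar_modular_le_one:
  assumes f: "f \<in> Lvar U q" and q: "\<And>x. x \<in> U \<Longrightarrow> 1 \<le> q x" and qm: "q \<in> borel_measurable (lebesgue_on U)"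
  obtains l where "0 < l" "modular U q (\<lambda>x. f x / l) \<le> 1"
proof -
  have fm: "f \<in> borel_measurable (lebesgue_on U)" using f by (simp add: Lvar_def)
  obtain l where l: "0 < l" "modular U q (\<lambda>x. f x / l) < \<infinity>" using f by (auto simp: Lvar_def)
  obtain c where c: "0 \<le> c" "modular U q (\<lambda>x. f x / l) = ennreal c"
    using l(2) less_top_ennreal by auto
  define d where "d = max 1 c"
  have d: "1 \<le> d" "c \<le> d" by (auto simp: d_def)
  have "modular U q (\<lambda>x. f x / l / d) \<le> ennreal (1 / d) * ennreal c"
    unfolding c(2)[symmetric] using fm q qm d by (intro modular_mono_scale) auto
  also have "\<dots> = ennreal (c / d)" using c d by (simp flip: ennreal_mult)
  also have "\<dots> \<le> 1" using c d by (simp add: ennreal_le_1)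
  finally show ?thesis using that[of "l * d"] l d by simp
qed

text \<open>At each point the sum is at most a constant times the largest |f_k|, which is one of the
  f_k; its modular is therefore bounded by the sum of the individual modulars.\<close>

lemma lr_sum_in_Lvar:
  assumes r: "1 < r" and f: "\<And>k. k \<in> {1..N} \<Longrightarrow> f k \<in> Lvar U q"
    and q: "\<And>x. x \<in> U \<Longrightarrow> 1 \<le> q x" and qm: "q \<in> borel_measurable (lebesgue_on U)"
  shows "lr_sum r N f \<in> Lvar U q"
proof -
  have fm: "\<And>k. k \<in> {1..N} \<Longrightarrow> f k \<in> borel_measurable (lebesgue_on U)" using f by (simp add: Lvar_def)
  have "\<forall>k\<in>{1..N}. \<exists>l>0. modular U q (\<lambda>x. f k x / l) < \<infinity>" using f by (auto simp: Lvar_def)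
  then obtain l where l: "\<And>k. k \<in> {1..N} \<Longrightarrow> 0 < l k" "\<And>k. k \<in> {1..N} \<Longrightarrow> modular U q (\<lambda>x. f k x / l k) < \<infinity>"
    by metis
  define L where "L = 1 + (\<Sum>k=1..N. l k)"
  have Lk: "l k \<le> L" if "k \<in> {1..N}" for k
    using member_le_sum[of k "{1..N}" l] l(1) that by (auto simp: L_def less_imp_le)
  have L: "0 < L" using l(1) by (smt (verit) L_def sum_nonneg)
  \<comment> \<open>N + 1 keeps c positive for the empty family; the summand 1 in \<open>L\<close>
    has the same purpose.\<close>
  define c where "c = real (N + 1) powr (1 / r)"
  have c: "0 < c" by (simp add: c_def)
  have meas: "lr_sum r N f \<in> borel_measurable (lebesgue_on U)"
  proof -
    have "(\<lambda>x. (\<Sum>k=1..N. \<bar>f k x\<bar> powr r) powr (1 / r)) \<in> borel_measurable (lebesgue_on U)"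
      using fm by (intro powr_real_measurable borel_measurable_sum borel_measurable_abs borel_measurable_const) auto
    then show ?thesis by (simp add: lr_sum_def[abs_def])
  qed
  have "modular U q (\<lambda>x. lr_sum r N f x / (c * L)) \<le> (\<integral>\<^sup>+x. (\<Sum>k=1..N. ennreal (\<bar>f k x / l k\<bar> powr q x)) \<partial>lebesgue_on U)"
    unfolding modular_def
  proof (rule nn_integral_mono)
    fix x assume "x \<in> space (lebesgue_on U)"
    then have x: "1 \<le> q x" using q by (simp add: space_restrict_space)
    show "ennreal (\<bar>lr_sum r N f x / (c * L)\<bar> powr q x) \<le> (\<Sum>k=1..N. ennreal (\<bar>f k x / l k\<bar> powr q x))"
    proof (cases "N = 0")
      case True
      then show ?thesis by (simp add: lr_sum_def)
    next
      case False
      define b where "b = Max ((\<lambda>k. \<bar>f k x\<bar>) ` {1..N})"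
      have "b \<in> (\<lambda>k. \<bar>f k x\<bar>) ` {1..N}" unfolding b_def using False by (intro Max_in) auto
      then obtain j where j: "j \<in> {1..N}" "b = \<bar>f j x\<bar>" by auto
      have b: "\<bar>f k x\<bar> \<le> b" if "k \<in> {1..N}" for k unfolding b_def using that by (intro Max_ge) auto
      have "lr_sum r N f x \<le> (real (N + 1) * b powr r) powr (1 / r)"
        unfolding lr_sum_def
      proof (rule powr_mono2)
        have "(\<Sum>k=1..N. \<bar>f k x\<bar> powr r) \<le> (\<Sum>k=1..N. b powr r)"
          using b r by (intro sum_mono powr_mono2) auto
        also have "\<dots> \<le> real (N + 1) * b powr r" by (simp add: algebra_simps)
        finally show "(\<Sum>k=1..N. \<bar>f k x\<bar> powr r) \<le> real (N + 1) * b powr r" .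
      qed (use r in \<open>auto simp: sum_nonneg\<close>)
      also have "\<dots> = c * b" using r j by (simp add: c_def powr_mult powr_powr)
      finally have "lr_sum r N f x / (c * L) \<le> b / L" using c L by (simp add: field_simps)
      also have "\<dots> \<le> b / l j" using Lk[OF j(1)] l(1)[OF j(1)] L j(2) by (intro divide_left_mono) auto
      also have "\<dots> = \<bar>f j x / l j\<bar>" using j(2) l(1)[OF j(1)] by simp
      finally have "\<bar>lr_sum r N f x / (c * L)\<bar> powr q x \<le> \<bar>f j x / l j\<bar> powr q x"
        using x c L by (intro powr_mono2) auto
      then have "ennreal (\<bar>lr_sum r N f x / (c * L)\<bar> powr q x) \<le> ennreal (\<bar>f j x / l j\<bar> powr q x)" by (rule ennreal_leI)
      also have "\<dots> \<le> (\<Sum>k=1..N. ennreal (\<bar>f k x / l k\<bar> powr q x))"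
        using j by (intro member_le_sum) auto
      finally show ?thesis .
    qed
  qed
  also have "\<dots> = (\<Sum>k=1..N. modular U q (\<lambda>x. f k x / l k))"
    unfolding modular_def
  proof (rule nn_integral_sum)
    fix k assume "k \<in> {1..N}"
    then have [measurable]: "f k \<in> borel_measurable (lebesgue_on U)" by (rule fm)
    note [measurable] = qm
    show "(\<lambda>x. ennreal (\<bar>f k x / l k\<bar> powr q x)) \<in> borel_measurable (lebesgue_on U)" by measurable
  qed
  also have "\<dots> < \<infinity>" using l(2) by simp
  finally show ?thesis unfolding Lvar_def using meas c L by (intro CollectI conjI exI[of _ "c * L"]) auto
qed

section \<open>Boundedness of the rough fractional integral\<close>

text \<open>Conjugation reverses the order, so q' \<le> s becomes q \<ge> s', with s' = s / (s -
  1).\<close>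

lemma AE_exponent_ge_conjugate:
  assumes s: "1 < s" and q: "\<And>x. x \<in> U \<Longrightarrow> 1 \<le> q x"
    and ess: "esssup (lebesgue_on U) (\<lambda>x. conjugate_exponent (ereal (q x))) \<le> ereal s"
  shows "AE x in lebesgue_on U. s / (s - 1) \<le> q x"
proof -
  have "AE x in lebesgue_on U. conjugate_exponent (ereal (q x)) \<le> esssup (lebesgue_on U) (\<lambda>x. conjugate_exponent (ereal (q x)))"
    by (rule esssup_AE)
  moreover have "AE x in lebesgue_on U. x \<in> U"
    using AE_space[of "lebesgue_on U"] by (simp add: space_restrict_space)
  ultimately show ?thesis
  proof eventually_elim
    case (elim x)
    have q1: "1 \<le> q x" using q elim by simp
    have le: "conjugate_exponent (ereal (q x)) \<le> ereal s" using elim ess by (metis order_trans)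
    have c: "conjugate_exponent (ereal (q x)) = inverse (ereal (1 - 1 / q x))"
      using q1 by (simp add: conjugate_exponent_def one_ereal_def divide_inverse)
    show ?case
    proof (cases "q x = 1")
      \<comment> \<open>At q = 1 the conjugate exponent is \<infinity>, which contradicts the finite
        bound s.\<close>
      case True
      then show ?thesis using le c by simp
    next
      case False
      then have "1 < q x" using q1 by simp
      then have "inverse (1 - 1 / q x) \<le> s" using le c by simp
      then show ?thesis using \<open>1 < q x\<close> s by (simp add: field_simps)
    qed
  qed
qed

lemma AE_exponent_le:
  assumes "q \<in> bounded_exponents U"
  shows "\<exists>M\<ge>1. AE x in lebesgue_on U. q x \<le> M"
proof -
  have "1 < exp_plus U q" "exp_plus U q < \<infinity>" using assms by (auto simp: bounded_exponents_def)
  then obtain M where M: "exp_plus U q = ereal M" "1 < M" by (cases "exp_plus U q") auto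
  have "AE x in lebesgue_on U. ereal (q x) \<le> exp_plus U q" unfolding exp_plus_def by (rule esssup_AE)
  then have "AE x in lebesgue_on U. q x \<le> M" by (simp add: M)
  then show ?thesis using M by (intro exI[of _ M]) auto
qed

text \<open>The scalar estimate for h in the unit ball of the modular. The pointwise bound by
  R^(1/p) together with the integral bound on R controls the p-modular of the operator; C is
  independent of h, while R depends on it.\<close>

lemma rough_potential_bound:
  fixes U :: "'a::euclidean_space set"
    and s :: real
    and \<Omega> q \<alpha> p :: "'a \<Rightarrow> real"
  assumes U: "open U" "bounded U"
    and s: "1 < s"
    and \<Omega>: "\<Omega> \<in> homogeneous_Ls s"
    and q: "q \<in> bounded_exponents U" "log_condition U q"
    and a0: "0 < a0" "\<And>x. x \<in> U \<Longrightarrow> a0 \<le> \<alpha> x"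
    and t: "t < real DIM('a)" "\<And>x. x \<in> U \<Longrightarrow> \<alpha> x * q x \<le> t"
    and conj: "esssup (lebesgue_on U) (\<lambda>x. conjugate_exponent (ereal (q x))) \<le> ereal s"
    and p: "\<And>x. x \<in> U \<Longrightarrow> 1 / p x = 1 / q x - \<alpha> x / real DIM('a)"
  shows "\<exists>C\<ge>1. \<forall>h. h \<in> borel_measurable (lebesgue_on U) \<longrightarrow> (\<forall>x. 0 \<le> h x) \<longrightarrow> modular U q h \<le> 1 \<longrightarrow>
    (\<exists>R\<in>borel_measurable (lebesgue_on U). (AE x in lebesgue_on U. 1 \<le> R x \<and>
        (\<integral>\<^sup>+y. ennreal \<bar>frac_integrand U \<Omega> \<alpha> h x y\<bar> \<partial>lebesgue) \<le> ennreal (C * R x powr (1 / p x))) \<and>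
      (\<integral>\<^sup>+x. ennreal (R x) \<partial>lebesgue_on U) \<le> ennreal C)"
proof -
  define n where "n = real DIM('a)"
  have n: "0 < n" by (simp add: n_def)
  have Us: "U \<in> sets lebesgue" using U by auto
  have q1: "1 \<le> q x" if "x \<in> U" for x using q that by (auto simp: bounded_exponents_def)
  have qm: "q \<in> borel_measurable (lebesgue_on U)" using q by (auto simp: bounded_exponents_def)
  define m where "m = s / (s - 1)"
  have m: "1 < m" "1 < s" "1 / m + 1 / s = 1" using s by (auto simp: m_def field_simps)
  have mq: "AE x in lborel. x \<in> U \<longrightarrow> m \<le> q x"
    using AE_exponent_ge_conjugate[OF s q1 conj] Us unfolding m_def by (simp add: AE_lebesgue_on_iff)
  obtain M where M: "1 \<le> M" "AE x in lebesgue_on U. q x \<le> M" using AE_exponent_le[OF q(1)] by blast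
  have qM: "AE x in lborel. x \<in> U \<longrightarrow> q x \<le> M" using M(2) Us by (simp add: AE_lebesgue_on_iff)
  obtain A where A: "0 < A" "\<And>x y. x \<in> U \<Longrightarrow> y \<in> U \<Longrightarrow> norm (x - y) \<le> 1 / 2 \<Longrightarrow>
     \<bar>q x - q y\<bar> \<le> A / (- ln (norm (x - y)))"
    using q(2) by (auto simp: log_condition_def)
  obtain B where B: "\<And>x. x \<in> U \<Longrightarrow> norm x \<le> B" using U(2) by (auto simp: bounded_iff)
  define D where "D = max 2 (2 * B)"
  have D2: "2 \<le> D" by (simp add: D_def)
  have D: "norm (x - y) \<le> D" if "x \<in> U" "y \<in> U" for x y
  proof -
    have "norm (x - y) \<le> norm x + norm y" by (rule norm_triangle_ineq4)
    then show "norm (x - y) \<le> D" using B[of x] B[of y] that by (simp add: D_def)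
  qed
  \<comment> \<open>The three entries secure \<eta> \<le> \<alpha>(x), \<eta> \<le> n/s and \<eta>
    \<le> n/p(x); the last holds because n/p = (n - \<alpha> q)/q \<ge> (n - t)/M almost everywhere
    on U.\<close>
  define \<eta> where "\<eta> = min (min a0 (n / s)) ((n - t) / M)"
  have \<eta>: "0 < \<eta>" using a0 n s t M by (auto simp: \<eta>_def n_def)
  obtain \<Omega>' where \<Omega>': "\<Omega>' \<in> borel_measurable borel" "\<And>t x. 0 < t \<Longrightarrow> x \<noteq> 0 \<Longrightarrow> \<Omega>' (t *\<^sub>R x) = \<Omega>' x"
    "AE z in lborel. \<Omega> z = \<Omega>' z" "(\<integral>\<^sup>+z. ennreal (\<bar>\<Omega>' z\<bar> powr s) * indicator (ball 0 1) z \<partial>lborel) < \<infinity>"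
    using homogeneous_Ls_borel_version[OF \<Omega>] by blast
  \<comment> \<open>The lower bound 1 gives \<omega> \<le> \<omega>^s, so one weight serves all
    terms.\<close>
  define \<omega> where "\<omega> z = max 1 \<bar>\<Omega>' z\<bar>" for z
  note [measurable] = \<Omega>'(1)
  have \<omega>m[measurable]: "\<omega> \<in> borel_measurable borel" unfolding \<omega>_def by measurable
  have \<omega>1: "1 \<le> \<omega> z" "\<bar>\<Omega>' z\<bar> \<le> \<omega> z" for z by (auto simp: \<omega>_def)
  have "(\<integral>\<^sup>+z. ennreal (\<omega> z powr s) * indicator (ball 0 1) z \<partial>lborel) \<le>
     (\<integral>\<^sup>+z. indicator (ball 0 1) z + ennreal (\<bar>\<Omega>' z\<bar> powr s) * indicator (ball 0 1) z \<partial>lborel)"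
  proof (rule nn_integral_mono)
    fix z
    have "\<omega> z powr s \<le> 1 + \<bar>\<Omega>' z\<bar> powr s" by (auto simp: \<omega>_def max_def)
    then have "ennreal (\<omega> z powr s) \<le> 1 + ennreal (\<bar>\<Omega>' z\<bar> powr s)"
      by (simp flip: ennreal_1 ennreal_plus add: ennreal_leI)
    then show "ennreal (\<omega> z powr s) * indicator (ball 0 1) z \<le> indicator (ball 0 1) z + ennreal (\<bar>\<Omega>' z\<bar> powr s) * indicator (ball 0 1) z"
      by (auto simp: indicator_def)
  qed
  also have "\<dots> = emeasure lborel (ball (0::'a) 1) + (\<integral>\<^sup>+z. ennreal (\<bar>\<Omega>' z\<bar> powr s) * indicator (ball 0 1) z \<partial>lborel)"
    by (subst nn_integral_add) auto
  also have "\<dots> < \<infinity>" using \<Omega>'(4) emeasure_lborel_ball_finite[of 0 1] by simp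
  finally have "(\<integral>\<^sup>+z. ennreal (\<omega> z powr s) * indicator (ball 0 1) z \<partial>lborel) < \<infinity>" .
  then obtain K where K: "0 \<le> K" "\<And>l. 0 \<le> l \<Longrightarrow>
      (\<integral>\<^sup>+z. ennreal (\<omega> z powr s) * ennreal (damped_kernel \<eta> l z) \<partial>lborel) \<le> ennreal K"
    using homogeneous_integral_damped_kernel[of "\<lambda>z. ennreal (\<omega> z powr s)" \<eta>] \<eta> \<Omega>'(2) by (auto simp: \<omega>_def)
  define C1 where "C1 = (1 + exp (DIM('a) * A / m) + 2 powr DIM('a) * (2 * D powr (DIM('a) + \<eta>))) * (2 + 2 * K)"
  define V where "V = measure lebesgue U"
  have V: "emeasure lebesgue U = ennreal V" unfolding V_def
    using U emeasure_bounded_finite[OF U(2)] by (intro emeasure_eq_ennreal_measure) auto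
  define C where "C = max 1 (max C1 (V + K))"
  show ?thesis
  proof (intro exI[of _ C] conjI allI impI)
    show "1 \<le> C" by (simp add: C_def)
  next
    fix h :: "'a \<Rightarrow> real"
    assume hm: "h \<in> borel_measurable (lebesgue_on U)" and h0: "\<forall>x. 0 \<le> h x" and mod: "modular U q h \<le> 1"
    note [measurable] = hm qm
    have "(\<lambda>y. h y powr q y) \<in> borel_measurable (lebesgue_on U)" by measurable
    then obtain \<Phi>0 where \<Phi>0: "\<Phi>0 \<in> borel_measurable borel" "AE y in lborel. \<Phi>0 y = (if y \<in> U then h y powr q y else 0)"
      using borel_version_on[OF Us] by blast
    \<comment> \<open>The absolute value makes the Borel version nonnegative everywhere and changes
      it only on a null set.\<close>
    define \<Phi> where "\<Phi> y = \<bar>\<Phi>0 y\<bar>" for y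
    have \<Phi>m[measurable]: "\<Phi> \<in> borel_measurable borel" unfolding \<Phi>_def using \<Phi>0(1) by measurable
    have \<Phi>nn: "0 \<le> \<Phi> y" for y by (simp add: \<Phi>_def)
    have \<Phi>: "AE y in lborel. \<Phi> y = (if y \<in> U then h y powr q y else 0)"
      using \<Phi>0(2) by eventually_elim (auto simp: \<Phi>_def)
    have "(\<integral>\<^sup>+y. ennreal (\<Phi> y) \<partial>lborel) = (\<integral>\<^sup>+y. ennreal (\<bar>h y\<bar> powr q y) * indicator U y \<partial>lborel)"
      by (rule nn_integral_cong_AE) (use \<Phi> h0 in \<open>auto elim!: eventually_mono simp: indicator_def\<close>)
    also have "\<dots> = modular U q h"
      unfolding modular_def using Us by (subst nn_integral_restrict_space) (auto simp: nn_integral_completion)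
    finally have \<Phi>int: "(\<integral>\<^sup>+y. ennreal (\<Phi> y) \<partial>lborel) \<le> 1" using mod by simp
    define P where "P = damped_potential \<eta> (\<lambda>z. ennreal (\<omega> z powr s)) \<Phi>"
    have Pm[measurable]: "P \<in> borel_measurable borel" unfolding P_def by measurable
    have "(\<integral>\<^sup>+x. P x \<partial>lborel) \<le> ennreal K * (\<integral>\<^sup>+y. ennreal (\<Phi> y) \<partial>lborel)"
      unfolding P_def using \<Phi>nn K by (intro nn_integral_damped_potential_le) auto
    also have "\<dots> \<le> ennreal K * 1" by (intro mult_left_mono \<Phi>int) auto
    finally have Pint: "(\<integral>\<^sup>+x. P x \<partial>lborel) \<le> ennreal K" by simp
    have Pfin: "AE x in lborel. P x \<noteq> \<infinity>"
    proof (rule nn_integral_PInf_AE)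
      have "(\<integral>\<^sup>+x. P x \<partial>lborel) < \<infinity>" using Pint by (rule le_less_trans) simp
      then show "(\<integral>\<^sup>+x. P x \<partial>lborel) \<noteq> \<infinity>" by simp
    qed simp
    \<comment> \<open>\<open>enn2real\<close> sends \<infinity> to 0, so R dominates the potential
      only where that is finite, which by \<open>Pfin\<close> is almost everywhere. The integral
      bound on R holds regardless.\<close>
    define R where "R x = 1 + enn2real (P x)" for x
    show "\<exists>R\<in>borel_measurable (lebesgue_on U). (AE x in lebesgue_on U. 1 \<le> R x \<and>
        (\<integral>\<^sup>+y. ennreal \<bar>frac_integrand U \<Omega> \<alpha> h x y\<bar> \<partial>lebesgue) \<le> ennreal (C * R x powr (1 / p x))) \<and>
      (\<integral>\<^sup>+x. ennreal (R x) \<partial>lebesgue_on U) \<le> ennreal C"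
    proof (intro bexI[of _ R] conjI)
      have "R \<in> borel_measurable borel" unfolding R_def by measurable
      then show "R \<in> borel_measurable (lebesgue_on U)"
        by (intro measurable_restrict_space1 measurable_completion) simp
      have "(\<integral>\<^sup>+x. ennreal (R x) \<partial>lebesgue_on U) = (\<integral>\<^sup>+x. ennreal (R x) * indicator U x \<partial>lebesgue)"
        using Us by (subst nn_integral_restrict_space) auto
      also have "\<dots> \<le> (\<integral>\<^sup>+x. indicator U x + P x \<partial>lebesgue)"
      proof (rule nn_integral_mono)
        fix x
        have "ennreal (R x) = 1 + ennreal (enn2real (P x))" by (simp add: R_def)
        also have "\<dots> \<le> 1 + P x" by (cases "P x") (auto simp: ennreal_enn2real_if)
        finally show "ennreal (R x) * indicator U x \<le> indicator U x + P x"
          by (auto simp: indicator_def)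
      qed
      also have "\<dots> = (\<integral>\<^sup>+x. indicator U x \<partial>lebesgue) + (\<integral>\<^sup>+x. P x \<partial>lebesgue)"
        using Us by (intro nn_integral_add) (auto intro!: measurable_completion)
      also have "\<dots> \<le> ennreal V + ennreal K"
      proof (rule add_mono)
        show "(\<integral>\<^sup>+x. indicator U x \<partial>lebesgue) \<le> ennreal V" using Us V by simp
        show "(\<integral>\<^sup>+x. P x \<partial>lebesgue) \<le> ennreal K" unfolding nn_integral_completion by (rule Pint)
      qed
      also have "\<dots> = ennreal (V + K)" using K by (simp add: V_def)
      also have "\<dots> \<le> ennreal C" by (intro ennreal_leI) (simp add: C_def)
      finally show "(\<integral>\<^sup>+x. ennreal (R x) \<partial>lebesgue_on U) \<le> ennreal C" .
      have "AE x in lborel. x \<in> U \<longrightarrow> 1 \<le> R x \<and>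
        (\<integral>\<^sup>+y. ennreal \<bar>frac_integrand U \<Omega> \<alpha> h x y\<bar> \<partial>lborel) \<le> ennreal (C * R x powr (1 / p x))"
        using qM Pfin
      proof (eventually_elim, intro impI conjI)
        fix x assume xM: "x \<in> U \<longrightarrow> q x \<le> M" and Px: "P x \<noteq> \<infinity>" and x: "x \<in> U"
        show R1: "1 \<le> R x" by (simp add: R_def)
        have \<alpha>0: "0 < \<alpha> x" "a0 \<le> \<alpha> x" using a0 x by (auto intro: less_le_trans)
        have "\<alpha> x * 1 \<le> \<alpha> x * q x" using q1[OF x] \<alpha>0 by (intro mult_left_mono) auto
        then have \<alpha>n: "\<alpha> x \<le> n" using t(1) t(2)[OF x] by (simp add: n_def)
        have "n / p x = n * (1 / q x - \<alpha> x / n)" unfolding n_def p[OF x, symmetric] by simp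
        also have "\<dots> = (n - \<alpha> x * q x) / q x" using q1[OF x] n by (simp add: field_simps)
        finally have np: "n / p x = (n - \<alpha> x * q x) / q x" .
        have "(n - t) / M \<le> (n - \<alpha> x * q x) / q x"
          using t(1) t(2)[OF x] x xM q1[OF x] by (intro frac_le) (auto simp: n_def)
        then have \<eta>p: "\<eta> \<le> n / p x" unfolding np by (simp add: \<eta>_def)
        have PR: "P x \<le> ennreal (R x)"
        proof (cases "P x")
          case (real c)
          then show ?thesis by (simp add: R_def ennreal_leI)
        qed (use Px in simp)
        have "(\<integral>\<^sup>+y. ennreal \<bar>frac_integrand U \<Omega> \<alpha> h x y\<bar> \<partial>lborel) \<le>
           (\<integral>\<^sup>+y. ennreal (\<omega> (x - y) * norm (x - y) powr (\<alpha> x - DIM('a)) * (if y \<in> U then h y else 0)) \<partial>lborel)"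
        proof (rule nn_integral_mono_AE)
          show "AE y in lborel. ennreal \<bar>frac_integrand U \<Omega> \<alpha> h x y\<bar> \<le>
            ennreal (\<omega> (x - y) * norm (x - y) powr (\<alpha> x - DIM('a)) * (if y \<in> U then h y else 0))"
            using AE_lborel_reflect[OF \<Omega>'(3), of x]
          proof eventually_elim
            case (elim y)
            have "\<bar>frac_integrand U \<Omega> \<alpha> h x y\<bar> = \<bar>\<Omega>' (x - y)\<bar> * norm (x - y) powr (\<alpha> x - DIM('a)) * (if y \<in> U then h y else 0)"
              using h0 elim powr_minus_divide[of "norm (x - y)" "real DIM('a) - \<alpha> x"]
              by (simp add: frac_integrand_def abs_mult)
            also have "\<dots> \<le> \<omega> (x - y) * norm (x - y) powr (\<alpha> x - DIM('a)) * (if y \<in> U then h y else 0)"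
              using h0 \<omega>1(2) by (intro mult_right_mono) auto
            finally show ?case by (rule ennreal_leI)
          qed
        qed
        also have "\<dots> \<le> ennreal (C1 * R x powr (1 / p x))"
          unfolding C1_def
        proof (rule kernel_potential_bound[where m = m and s = s and \<Phi> = \<Phi> and r = q and q = "q x"])
          show "\<eta> \<le> \<alpha> x" using \<alpha>0 by (simp add: \<eta>_def)
          show "\<eta> \<le> DIM('a) / s" by (simp add: \<eta>_def n_def)
          show "damped_potential \<eta> (\<lambda>z. ennreal (\<omega> z powr s)) \<Phi> x \<le> ennreal (R x)" using PR by (simp add: P_def)
          show "AE y in lborel. (if y \<in> U then h y else 0) = 0 \<or> (0 \<le> (if y \<in> U then h y else 0) \<and> norm (x - y) \<le> D \<and>
             m \<le> q y \<and> \<Phi> y = (if y \<in> U then h y else 0) powr q y \<and>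
            (norm (x - y) \<le> 1 / 2 \<longrightarrow> \<bar>q x - q y\<bar> \<le> A / (- ln (norm (x - y)))))"
            using \<Phi> mq
          proof eventually_elim
            case (elim y)
            then show ?case using x h0 D[OF x] A(2)[OF x] by auto
          qed
        qed (use m \<eta> \<eta>p \<alpha>n q1[OF x] p[OF x] \<omega>m \<omega>1 \<Phi>nn \<Phi>int K R1 A D2 in \<open>auto simp: n_def\<close>)
        also have "\<dots> \<le> ennreal (C * R x powr (1 / p x))"
          by (intro ennreal_leI mult_right_mono) (auto simp: C_def)
        finally show "(\<integral>\<^sup>+y. ennreal \<bar>frac_integrand U \<Omega> \<alpha> h x y\<bar> \<partial>lborel) \<le> ennreal (C * R x powr (1 / p x))" .
      qed
      then show "AE x in lebesgue_on U. 1 \<le> R x \<and>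
        (\<integral>\<^sup>+y. ennreal \<bar>frac_integrand U \<Omega> \<alpha> h x y\<bar> \<partial>lebesgue) \<le> ennreal (C * R x powr (1 / p x))"
        unfolding AE_lebesgue_on_iff[OF Us] nn_integral_completion .
    qed
  qed
qed

section \<open>From the potential estimate to norms of finite families\<close>

lemma Lvar_norm_le:
  assumes "0 < l" "modular U q (\<lambda>x. f x / l) \<le> 1"
  shows "Lvar_norm U q f \<le> l"
  unfolding Lvar_norm_def by (rule cInf_lower) (use assms in \<open>auto intro!: bdd_belowI[of _ 0]\<close>)

text \<open>In each of the three cases the interval lies above min 2 b. The conclusion is the range
  in which Minkowski's inequality is applied.\<close>

lemma I_interval_gt_one:
  assumes "ereal r \<in> I_interval a b" "1 < b"
  shows "1 < r"
proof -
  have "min 2 b \<le> ereal r"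
    using assms(1)
    by (auto simp: I_interval_def split: if_splits intro: min.coboundedI1 min.coboundedI2 less_imp_le)
  moreover have "1 < min 2 b" using assms(2) by simp
  ultimately have "1 < ereal r" by (rule less_le_trans[rotated])
  then show ?thesis by simp
qed

theorem corollary4p4:
  fixes U :: "'a::euclidean_space set"
    and s :: real
    and \<Omega> q \<alpha> p :: "'a \<Rightarrow> real"
  assumes "open U" and "bounded U"
    and "1 < s"
    and "\<Omega> \<in> homogeneous_Ls s"
    and "q \<in> bounded_exponents U"
    and "log_condition U q"
    and "\<alpha> \<in> borel_measurable (lebesgue_on U)"
    and "(INF x\<in>U. ereal (\<alpha> x)) > 0"
    and "(SUP x\<in>U. ereal (\<alpha> x * q x)) < ereal (real DIM('a))"
    and "ereal s \<ge> esssup (lebesgue_on U) (\<lambda>x. conjugate_exponent (ereal (q x)))"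
    and "\<forall>x\<in>U. 1 / p x = 1 / q x - \<alpha> x / real DIM('a)"
  shows "\<forall>r::real. ereal r \<in> I_interval (exp_minus U p) (exp_plus U q) \<longrightarrow>
    (\<exists>C>0. \<forall>(N::nat) (f :: nat \<Rightarrow> 'a \<Rightarrow> real). (\<forall>k\<in>{1..N}. f k \<in> Lvar U q) \<longrightarrow>
       (\<forall>k\<in>{1..N}. AE x in lebesgue_on U. integrable lebesgue (frac_integrand U \<Omega> \<alpha> (f k) x)) \<and>
       lr_sum r N (\<lambda>k. frac_integral U \<Omega> \<alpha> (f k)) \<in> Lvar U p \<and>
       Lvar_norm U p (lr_sum r N (\<lambda>k. frac_integral U \<Omega> \<alpha> (f k)))
         \<le> C * Lvar_norm U q (lr_sum r N f))"
proof (intro allI impI)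
  fix r :: real
  assume r: "ereal r \<in> I_interval (exp_minus U p) (exp_plus U q)"
  have "1 < exp_plus U q" using assms(5) by (auto simp: bounded_exponents_def)
  with r have r1: "1 < r" by (rule I_interval_gt_one)
  have Us: "U \<in> sets lebesgue" using assms(1) by auto
  have q1: "1 \<le> q x" if "x \<in> U" for x using assms(5) that by (auto simp: bounded_exponents_def)
  have qm: "q \<in> borel_measurable (lebesgue_on U)" using assms(5) by (auto simp: bounded_exponents_def)
  note p = assms(11)[rule_format]
  obtain a0 where a0: "0 < a0" "\<And>x. x \<in> U \<Longrightarrow> a0 \<le> \<alpha> x"
  proof -
    obtain a where a: "0 < ereal a" "ereal a < (INF x\<in>U. ereal (\<alpha> x))"
      using ereal_dense2[OF assms(8)] by (auto simp: zero_ereal_def)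
    have "a \<le> \<alpha> x" if "x \<in> U" for x
      using less_INF_D[OF a(2) that] by simp
    then show ?thesis using a(1) that by auto
  qed
  obtain t where t: "t < real DIM('a)" "\<And>x. x \<in> U \<Longrightarrow> \<alpha> x * q x \<le> t"
  proof -
    obtain b where b: "(SUP x\<in>U. ereal (\<alpha> x * q x)) < ereal b" "ereal b < ereal (real DIM('a))"
      using ereal_dense2[OF assms(9)] by auto
    have "\<alpha> x * q x \<le> b" if "x \<in> U" for x
      using SUP_lessD[OF b(1) that] by simp
    then show ?thesis using b(2) that by auto
  qed
  have p1: "1 \<le> p x" if x: "x \<in> U" for x
  proof -
    have "1 / p x = (real DIM('a) - \<alpha> x * q x) / (real DIM('a) * q x)"
      using p[OF x] q1[OF x] by (simp add: field_simps)
    moreover have "0 < real DIM('a) - \<alpha> x * q x" using t(1) t(2)[OF x] by simp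
    ultimately have "0 < 1 / p x" using q1[OF x] by (simp add: zero_less_divide_iff)
    moreover have "1 / p x \<le> 1"
    proof -
      have "1 / q x \<le> 1" using q1[OF x] by simp
      moreover have "0 \<le> \<alpha> x / real DIM('a)" using a0(1) a0(2)[OF x] by simp
      ultimately show ?thesis using p[OF x] by linarith
    qed
    ultimately show ?thesis by (simp add: field_simps)
  qed
  have pm: "p \<in> borel_measurable (lebesgue_on U)"
  proof -
    note [measurable] = qm assms(7)
    \<comment> \<open>p is given only through its reciprocal; inverting twice expresses it by q and
      \<alpha>.\<close>
    have "(\<lambda>x. 1 / (1 / q x - \<alpha> x / real DIM('a))) \<in> borel_measurable (lebesgue_on U)" by measurable
    then show ?thesis
      by (rule measurable_cong[THEN iffD1, rotated]) (auto simp flip: p simp: space_restrict_space)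
  qed
  obtain C where C: "1 \<le> C" "\<And>h. h \<in> borel_measurable (lebesgue_on U) \<Longrightarrow> \<forall>x. 0 \<le> h x \<Longrightarrow> modular U q h \<le> 1 \<Longrightarrow>
    \<exists>R\<in>borel_measurable (lebesgue_on U). (AE x in lebesgue_on U. 1 \<le> R x \<and>
        (\<integral>\<^sup>+y. ennreal \<bar>frac_integrand U \<Omega> \<alpha> h x y\<bar> \<partial>lebesgue) \<le> ennreal (C * R x powr (1 / p x))) \<and>
      (\<integral>\<^sup>+x. ennreal (R x) \<partial>lebesgue_on U) \<le> ennreal C"
    using rough_potential_bound[OF assms(1-6) a0 t assms(10) p] by blast
  obtain \<Omega>' where \<Omega>': "\<Omega>' \<in> borel_measurable borel" "AE z in lborel. \<Omega> z = \<Omega>' z"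
    using homogeneous_Ls_borel_version[OF assms(4)] by blast
  show "\<exists>C>0. \<forall>(N::nat) (f :: nat \<Rightarrow> 'a \<Rightarrow> real). (\<forall>k\<in>{1..N}. f k \<in> Lvar U q) \<longrightarrow>
       (\<forall>k\<in>{1..N}. AE x in lebesgue_on U. integrable lebesgue (frac_integrand U \<Omega> \<alpha> (f k) x)) \<and>
       lr_sum r N (\<lambda>k. frac_integral U \<Omega> \<alpha> (f k)) \<in> Lvar U p \<and>
       Lvar_norm U p (lr_sum r N (\<lambda>k. frac_integral U \<Omega> \<alpha> (f k)))
         \<le> C * Lvar_norm U q (lr_sum r N f)"
  \<comment> \<open>One factor C comes from the pointwise bound, the other offsets the integral of
    R, which is at most C.\<close>
  proof (intro exI[of _ "C * C"] conjI[of "0 < C * C"] allI impI)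
    show "0 < C * C" using C(1) by simp
    fix N :: nat and f :: "nat \<Rightarrow> 'a \<Rightarrow> real"
    assume f: "\<forall>k\<in>{1..N}. f k \<in> Lvar U q"
    have fm: "\<And>k. k \<in> {1..N} \<Longrightarrow> f k \<in> borel_measurable (lebesgue_on U)" using f by (simp add: Lvar_def)
    define h where "h = lr_sum r N f"
    have hL: "h \<in> Lvar U q" unfolding h_def using r1 f q1 qm by (intro lr_sum_in_Lvar) auto
    have hm: "h \<in> borel_measurable (lebesgue_on U)" using hL by (simp add: Lvar_def)
    have h0: "0 \<le> h x" for x by (simp add: h_def)
    define g where "g = lr_sum r N (\<lambda>k. frac_integral U \<Omega> \<alpha> (f k))"
    have gm: "g \<in> borel_measurable (lebesgue_on U)"
    proof -
      have "frac_integral U \<Omega> \<alpha> (f k) \<in> borel_measurable (lebesgue_on U)" if "k \<in> {1..N}" for k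
        by (rule frac_integral_measurable[OF Us fm[OF that] assms(7) \<Omega>'])
      then have "(\<lambda>x. (\<Sum>k=1..N. \<bar>frac_integral U \<Omega> \<alpha> (f k) x\<bar> powr r) powr (1 / r)) \<in> borel_measurable (lebesgue_on U)"
        by (intro powr_real_measurable borel_measurable_sum borel_measurable_abs borel_measurable_const) auto
      then show ?thesis by (simp add: g_def lr_sum_def[abs_def])
    qed
    have meas: "frac_integrand U \<Omega> \<alpha> (f k) x \<in> borel_measurable lebesgue" if "k \<in> {1..N}" for k x
      by (rule frac_integrand_measurable[OF Us fm[OF that] \<Omega>'])
    have hmeas: "frac_integrand U \<Omega> \<alpha> h x \<in> borel_measurable lebesgue" for x
      by (rule frac_integrand_measurable[OF Us hm \<Omega>'])
    \<comment> \<open>The kernel and the cutoff to U are common to all k and come out of the sum,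
      leaving the integrand for h.\<close>
    have lr: "lr_sum r N (\<lambda>k. frac_integrand U \<Omega> \<alpha> (f k) x) y = \<bar>frac_integrand U \<Omega> \<alpha> h x y\<bar>" for x y
    proof -
      have "frac_integrand U \<Omega> \<alpha> u x y =
          (\<Omega> (x - y) / norm (x - y) powr (real DIM('a) - \<alpha> x) * (if y \<in> U then 1 else 0)) * u y" for u
        by (simp add: frac_integrand_def)
      then show ?thesis
        using lr_sum_eq_abs[of r N "\<lambda>y. \<Omega> (x - y) / norm (x - y) powr (real DIM('a) - \<alpha> x) * (if y \<in> U then 1 else 0)" f y] r1 h0[of y]
        by (simp add: lr_sum_def h_def abs_mult)
    qed
    \<comment> \<open>Every l admissible for the norm of h makes C^2 l admissible for the norm of
      g.\<close>
    have key: "(AE x in lebesgue_on U. integrable lebesgue (frac_integrand U \<Omega> \<alpha> h x)) \<and>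
       modular U p (\<lambda>x. g x / (C * C * l)) \<le> 1"
      if l: "0 < l" "modular U q (\<lambda>x. h x / l) \<le> 1" for l
    proof -
      obtain R where Rm: "R \<in> borel_measurable (lebesgue_on U)" and R: "AE x in lebesgue_on U. 1 \<le> R x \<and>
        (\<integral>\<^sup>+y. ennreal \<bar>frac_integrand U \<Omega> \<alpha> (\<lambda>x. h x / l) x y\<bar> \<partial>lebesgue) \<le> ennreal (C * R x powr (1 / p x))"
        "(\<integral>\<^sup>+x. ennreal (R x) \<partial>lebesgue_on U) \<le> ennreal C"
      proof -
        have "(\<lambda>x. h x / l) \<in> borel_measurable (lebesgue_on U)" using hm by simp
        moreover have "\<forall>x. 0 \<le> h x / l" using h0 l by simp
        ultimately show ?thesis using C(2)[of "\<lambda>x. h x / l"] l(2) that by blast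
      qed
      have inU: "AE x in lebesgue_on U. x \<in> U"
        using AE_space[of "lebesgue_on U"] by (simp add: space_restrict_space)
      have bound: "AE x in lebesgue_on U. 1 \<le> R x \<and> integrable lebesgue (frac_integrand U \<Omega> \<alpha> h x) \<and>
        (LINT y|lebesgue. \<bar>frac_integrand U \<Omega> \<alpha> h x y\<bar>) \<le> l * (C * R x powr (1 / p x))"
        using R(1)
      proof eventually_elim
        case (elim x)
        have "(\<integral>\<^sup>+y. ennreal \<bar>frac_integrand U \<Omega> \<alpha> h x y\<bar> \<partial>lebesgue) =
          (\<integral>\<^sup>+y. ennreal l * ennreal \<bar>frac_integrand U \<Omega> \<alpha> (\<lambda>x. h x / l) x y\<bar> \<partial>lebesgue)"
          using l by (intro nn_integral_cong) (simp add: frac_integrand_def abs_mult flip: ennreal_mult)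
        also have "\<dots> = ennreal l * (\<integral>\<^sup>+y. ennreal \<bar>frac_integrand U \<Omega> \<alpha> (\<lambda>x. h x / l) x y\<bar> \<partial>lebesgue)"
        proof (rule nn_integral_cmult)
          have [measurable]: "frac_integrand U \<Omega> \<alpha> (\<lambda>x. h x / l) x \<in> borel_measurable lebesgue"
            using hm by (intro frac_integrand_measurable[OF Us _ \<Omega>']) auto
          show "(\<lambda>y. ennreal \<bar>frac_integrand U \<Omega> \<alpha> (\<lambda>x. h x / l) x y\<bar>) \<in> borel_measurable lebesgue"
            by measurable
        qed
        also have "\<dots> \<le> ennreal l * ennreal (C * R x powr (1 / p x))"
          using elim by (intro mult_left_mono) auto
        also have "\<dots> = ennreal (l * (C * R x powr (1 / p x)))"
          using l C(1) by (simp flip: ennreal_mult)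
        finally have le: "(\<integral>\<^sup>+y. ennreal \<bar>frac_integrand U \<Omega> \<alpha> h x y\<bar> \<partial>lebesgue) \<le> ennreal (l * (C * R x powr (1 / p x)))" .
        have int: "integrable lebesgue (frac_integrand U \<Omega> \<alpha> h x)"
        proof (rule integrableI_bounded[OF hmeas])
          show "(\<integral>\<^sup>+y. ennreal (norm (frac_integrand U \<Omega> \<alpha> h x y)) \<partial>lebesgue) < \<infinity>"
            using le by (auto intro: le_less_trans)
        qed
        then have "ennreal (LINT y|lebesgue. \<bar>frac_integrand U \<Omega> \<alpha> h x y\<bar>) = (\<integral>\<^sup>+y. ennreal \<bar>frac_integrand U \<Omega> \<alpha> h x y\<bar> \<partial>lebesgue)"
          by (intro nn_integral_eq_integral[symmetric]) auto
        then have "ennreal (LINT y|lebesgue. \<bar>frac_integrand U \<Omega> \<alpha> h x y\<bar>) \<le> ennreal (l * (C * R x powr (1 / p x)))"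
          using le by simp
        then show ?case using int elim l C(1) by (subst (asm) ennreal_le_iff) auto
      qed
      have gb: "AE x in lebesgue_on U. 1 \<le> R x \<and> g x \<le> l * (C * R x powr (1 / p x))"
        using bound
      proof eventually_elim
        case (elim x)
        have "g x \<le> (LINT y|lebesgue. lr_sum r N (\<lambda>k. frac_integrand U \<Omega> \<alpha> (f k) x) y)"
        proof -
          have "integrable lebesgue (lr_sum r N (\<lambda>k. frac_integrand U \<Omega> \<alpha> (f k) x))"
          proof -
            have "lr_sum r N (\<lambda>k. frac_integrand U \<Omega> \<alpha> (f k) x) = (\<lambda>y. \<bar>frac_integrand U \<Omega> \<alpha> h x y\<bar>)"
              by (rule ext) (rule lr)
            then show ?thesis using elim by simp
          qed
          moreover have "integrable lebesgue (frac_integrand U \<Omega> \<alpha> (f k) x)" if k: "k \<in> {1..N}" for k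
          proof (rule Bochner_Integration.integrable_bound)
            show "integrable lebesgue (frac_integrand U \<Omega> \<alpha> h x)" using elim by simp
            show "AE y in lebesgue. norm (frac_integrand U \<Omega> \<alpha> (f k) x y) \<le> norm (frac_integrand U \<Omega> \<alpha> h x y)"
              using abs_le_lr_sum[of r k N "\<lambda>k. frac_integrand U \<Omega> \<alpha> (f k) x"] r1 k by (simp add: lr)
          qed (rule meas[OF k])
          ultimately show ?thesis
            using lr_sum_integral_le[OF r1, of N lebesgue "\<lambda>k. frac_integrand U \<Omega> \<alpha> (f k) x" x]
            by (simp add: g_def frac_integral_def lr_sum_def)
        qed
        then show ?case using elim by (simp add: lr)
      qed
      have "modular U p (\<lambda>x. g x / (C * C * l)) \<le> (\<integral>\<^sup>+x. ennreal (1 / C) * ennreal (R x) \<partial>lebesgue_on U)"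
        unfolding modular_def
      proof (rule nn_integral_mono_AE)
        show "AE x in lebesgue_on U. ennreal (\<bar>g x / (C * C * l)\<bar> powr p x) \<le> ennreal (1 / C) * ennreal (R x)"
          using gb inU
        proof eventually_elim
          case (elim x)
          have "g x / (C * C * l) \<le> R x powr (1 / p x) / C"
            using elim C(1) l by (simp add: field_simps)
          moreover have "0 \<le> g x" by (simp add: g_def)
          \<comment> \<open>Raising to the power p turns R^(1/p) / C into R / C^p, at most R / C
            because C \<ge> 1 and p \<ge> 1; the integral of R / C is at most 1.\<close>
          ultimately have "\<bar>g x / (C * C * l)\<bar> powr p x \<le> (R x powr (1 / p x) / C) powr p x"
            using C(1) l p1 elim by (intro powr_mono2) (auto intro: order_trans[OF zero_le_one])
          also have "\<dots> = R x * (1 / C powr p x)"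
            using p1[of x] elim by (simp add: powr_divide powr_powr)
          also have "\<dots> \<le> R x * (1 / C)"
          proof -
            have "C powr 1 \<le> C powr p x" using C(1) p1 elim by (intro powr_mono) auto
            then have "1 / C powr p x \<le> 1 / C" using C(1) by (intro divide_left_mono) auto
            then show ?thesis using elim by (intro mult_left_mono) auto
          qed
          finally have "ennreal (\<bar>g x / (C * C * l)\<bar> powr p x) \<le> ennreal (1 / C * R x)"
            by (intro ennreal_leI) (simp add: mult.commute)
          also have "\<dots> = ennreal (1 / C) * ennreal (R x)" using C(1) elim by (intro ennreal_mult) auto
          finally show ?case .
        qed
      qed
      also have "\<dots> = ennreal (1 / C) * (\<integral>\<^sup>+x. ennreal (R x) \<partial>lebesgue_on U)"
        using Rm by (intro nn_integral_cmult) simp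
      also have "\<dots> \<le> ennreal (1 / C) * ennreal C" by (intro mult_left_mono R) auto
      also have "\<dots> = 1" using C(1) by (simp flip: ennreal_mult)
      finally show ?thesis using bound by (auto elim!: eventually_mono)
    qed
    obtain l0 where l0: "0 < l0" "modular U q (\<lambda>x. h x / l0) \<le> 1"
      using Lvar_modular_le_one[OF hL q1 qm] by blast
    \<comment> \<open>Integrability is established explicitly, since the Bochner integral of a
      nonintegrable function is 0 by default and the norm bound alone would not exclude
      that.\<close>
    have "AE x in lebesgue_on U. integrable lebesgue (frac_integrand U \<Omega> \<alpha> (f k) x)" if k: "k \<in> {1..N}" for k
      using key[OF l0, THEN conjunct1]
    proof eventually_elim
      case (elim x)
      show ?case
      proof (rule Bochner_Integration.integrable_bound[OF elim])
        show "AE y in lebesgue. norm (frac_integrand U \<Omega> \<alpha> (f k) x y) \<le> norm (frac_integrand U \<Omega> \<alpha> h x y)"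
          using abs_le_lr_sum[of r k N "\<lambda>k. frac_integrand U \<Omega> \<alpha> (f k) x"] r1 k by (simp add: lr)
      qed (rule meas[OF k])
    qed
    moreover have "g \<in> Lvar U p"
      unfolding Lvar_def
    proof (intro CollectI conjI exI[of _ "C * C * l0"] gm)
      show "0 < C * C * l0" using C(1) l0 by simp
      show "modular U p (\<lambda>x. g x / (C * C * l0)) < \<infinity>"
        using key[OF l0] by (auto intro: le_less_trans)
    qed
    moreover have "Lvar_norm U p g \<le> C * C * Lvar_norm U q h"
    proof -
      \<comment> \<open>Dividing by C^2 makes the left side a lower bound of the set defining the
        norm of h, so the infimum over l can be taken.\<close>
      have "Lvar_norm U p g / (C * C) \<le> Lvar_norm U q h"
        unfolding Lvar_norm_def[of U q h]
      proof (rule cInf_greatest)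
        show "{l. 0 < l \<and> modular U q (\<lambda>x. h x / l) \<le> 1} \<noteq> {}" using l0 by blast
        fix l assume "l \<in> {l. 0 < l \<and> modular U q (\<lambda>x. h x / l) \<le> 1}"
        then have l: "0 < l" "modular U q (\<lambda>x. h x / l) \<le> 1" by auto
        have "Lvar_norm U p g \<le> C * C * l" using key[OF l] l C(1) by (intro Lvar_norm_le) auto
        then show "Lvar_norm U p g / (C * C) \<le> l" using C(1) by (simp add: field_simps)
      qed
      then show ?thesis using C(1) by (simp add: field_simps)
    qed
    ultimately show "(\<forall>k\<in>{1..N}. AE x in lebesgue_on U. integrable lebesgue (frac_integrand U \<Omega> \<alpha> (f k) x)) \<and>
       lr_sum r N (\<lambda>k. frac_integral U \<Omega> \<alpha> (f k)) \<in> Lvar U p \<and>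
       Lvar_norm U p (lr_sum r N (\<lambda>k. frac_integral U \<Omega> \<alpha> (f k))) \<le> C * C * Lvar_norm U q (lr_sum r N f)"
      unfolding g_def h_def by blast
  qed
qed

end
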